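(* Let $K$ be a field whose multiplicative group $K^\times$ is divisible, and let $\phi:K^\times\to K^\times$ be a surjective group endomorphism. Then $\ker\phi$ is a pseudofinite-cyclic group.
   Context: A group is pseudofinite-cyclic if it is elementarily equivalent (in the language of groups) to an ultraproduct of finite cyclic groups. *)

theory Defs
  imports "HOL-Algebra.Multiplicative_Group" "HOL-Algebra.Elementary_Groups"
begin

section \<open>First-order logic in the language of groups\<close>

datatype group_term =
    Var nat
  | One
  | Mul group_term group_term
  | Inv group_term

datatype group_formula =
    Eq group_term group_term
  | Neg group_formula
  | Conj group_formula group_formula
  | Exi nat group_formula

primrec term_vars :: "group_term \<Rightarrow> nat set" where
  "term_vars (Var v) = {v}"
| "term_vars One = {}"
| "term_vars (Mul s t) = term_vars s \<union> term_vars t"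
| "term_vars (Inv t) = term_vars t"

primrec free_vars :: "group_formula \<Rightarrow> nat set" where
  "free_vars (Eq s t) = term_vars s \<union> term_vars t"
| "free_vars (Neg p) = free_vars p"
| "free_vars (Conj p q) = free_vars p \<union> free_vars q"
| "free_vars (Exi v p) = free_vars p - {v}"

definition sentence :: "group_formula \<Rightarrow> bool" where
  "sentence p \<longleftrightarrow> free_vars p = {}"

primrec term_val :: "('a, 'b) monoid_scheme \<Rightarrow> (nat \<Rightarrow> 'a) \<Rightarrow> group_term \<Rightarrow> 'a" where
  "term_val G e (Var v) = e v"
| "term_val G e One = \<one>\<^bsub>G\<^esub>"
| "term_val G e (Mul s t) = term_val G e s \<otimes>\<^bsub>G\<^esub> term_val G e t"
| "term_val G e (Inv t) = inv\<^bsub>G\<^esub> (term_val G e t)"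

primrec sat :: "('a, 'b) monoid_scheme \<Rightarrow> (nat \<Rightarrow> 'a) \<Rightarrow> group_formula \<Rightarrow> bool" where
  "sat G e (Eq s t) \<longleftrightarrow> term_val G e s = term_val G e t"
| "sat G e (Neg p) \<longleftrightarrow> \<not> sat G e p"
| "sat G e (Conj p q) \<longleftrightarrow> sat G e p \<and> sat G e q"
| "sat G e (Exi v p) \<longleftrightarrow> (\<exists>a\<in>carrier G. sat G (e(v := a)) p)"

definition models :: "('a, 'b) monoid_scheme \<Rightarrow> group_formula \<Rightarrow> bool" where
  "models G p \<longleftrightarrow> (\<forall>e. range e \<subseteq> carrier G \<longrightarrow> sat G e p)"

definition elementarily_equivalent ::
    "('a, 'b) monoid_scheme \<Rightarrow> ('c, 'd) monoid_scheme \<Rightarrow> bool" where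
  "elementarily_equivalent G H \<longleftrightarrow> (\<forall>p. sentence p \<longrightarrow> (models G p \<longleftrightarrow> models H p))"


section \<open>Ultraproducts of groups\<close>

definition ultrafilter :: "'i filter \<Rightarrow> bool" where
  "ultrafilter F \<longleftrightarrow> F \<noteq> bot \<and> (\<forall>P. eventually P F \<or> eventually (\<lambda>i. \<not> P i) F)"

definition ultra_rel ::
    "'i filter \<Rightarrow> ('i \<Rightarrow> ('a, 'b) monoid_scheme) \<Rightarrow> (('i \<Rightarrow> 'a) \<times> ('i \<Rightarrow> 'a)) set" where
  "ultra_rel F G =
     {(f, g). f \<in> (\<Pi> i\<in>UNIV. carrier (G i)) \<and> g \<in> (\<Pi> i\<in>UNIV. carrier (G i)) \<and>
              (\<forall>\<^sub>F i in F. f i = g i)}"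

definition ultraproduct ::
    "'i filter \<Rightarrow> ('i \<Rightarrow> ('a, 'b) monoid_scheme) \<Rightarrow> ('i \<Rightarrow> 'a) set monoid" where
  "ultraproduct F G =
     \<lparr>carrier = (\<Pi> i\<in>UNIV. carrier (G i)) // ultra_rel F G,
      mult = (\<lambda>A B. \<Union>x\<in>A. \<Union>y\<in>B. ultra_rel F G `` {\<lambda>i. x i \<otimes>\<^bsub>G i\<^esub> y i}),
      one = ultra_rel F G `` {\<lambda>i. \<one>\<^bsub>G i\<^esub>}\<rparr>"


section \<open>Pseudofinite-cyclic and divisible groups\<close>

text \<open>
  HOL cannot quantify over the type of the index set inside a definition. Fixing the index type
  \<^typ>\<open>nat\<close> and the carrier type \<^typ>\<open>int\<close> loses nothing: lemma \<open>pseudofinite_cyclicI\<close> below shows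
  that ultraproducts over any index type of finite cyclic groups of any type give the same notion.
\<close>

definition pseudofinite_cyclic :: "('a, 'b) monoid_scheme \<Rightarrow> bool" where
  "pseudofinite_cyclic A \<longleftrightarrow> group A \<and>
     (\<exists>(F :: nat filter) (C :: nat \<Rightarrow> int monoid).
        ultrafilter F \<and>
        (\<forall>i. group (C i) \<and> cyclic_group (C i) \<and> finite (carrier (C i))) \<and>
        elementarily_equivalent A (ultraproduct F C))"

definition divisible_group :: "('a, 'b) monoid_scheme \<Rightarrow> bool" where
  "divisible_group G \<longleftrightarrow> group G \<and>
     (\<forall>x\<in>carrier G. \<forall>n::nat. n > 0 \<longrightarrow> (\<exists>y\<in>carrier G. y [^]\<^bsub>G\<^esub> n = x))"


section \<open>Independence of the choice of index and carrier types\<close>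

lemma term_val_closed:
  assumes "group G" "range e \<subseteq> carrier G"
  shows "term_val G e t \<in> carrier G"
proof -
  interpret group G by fact
  show ?thesis using assms(2) by (induction t) auto
qed

lemma term_val_cong:
  "(\<And>v. v \<in> term_vars t \<Longrightarrow> e v = e' v) \<Longrightarrow> term_val G e t = term_val G e' t"
  by (induction t) auto

lemma sat_cong:
  "(\<And>v. v \<in> free_vars p \<Longrightarrow> e v = e' v) \<Longrightarrow> sat G e p = sat G e' p"
proof (induction p arbitrary: e e')
  case (Eq s t)
  then show ?case using term_val_cong[of s e e' G] term_val_cong[of t e e' G] by auto
next
  case (Neg p)
  then show ?case by (metis free_vars.simps(2) sat.simps(2))
next
  case (Conj p q)
  have "sat G e p = sat G e' p" "sat G e q = sat G e' q"
    by (rule Conj.IH, rule Conj.prems, simp)+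
  then show ?case by simp
next
  case (Exi v p)
  have "sat G (e(v := a)) p = sat G (e'(v := a)) p" for a
    by (rule Exi.IH) (use Exi.prems in auto)
  then show ?case by simp
qed

lemma models_sentence:
  assumes "sentence p" "range e \<subseteq> carrier G"
  shows "models G p \<longleftrightarrow> sat G e p"
  unfolding models_def using assms sat_cong[of p _ e G] by (metis sentence_def empty_iff)

lemma sat_iso:
  assumes "group G" "group H" "h \<in> iso G H" "range e \<subseteq> carrier G"
  shows "sat H (\<lambda>w. h (e w)) p \<longleftrightarrow> sat G e p"
proof -
  interpret group_hom G H h
    using assms by (simp add: group_hom_def group_hom_axioms_def iso_def)
  have inj: "inj_on h (carrier G)" and img: "h ` carrier G = carrier H"
    using assms(3) by (auto simp: iso_def bij_betw_def)
  have val: "term_val H (\<lambda>w. h (e w)) t = h (term_val G e t)" if "range e \<subseteq> carrier G" for e t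
    using that term_val_closed[OF assms(1) that] by (induction t) auto
  show ?thesis using assms(4)
  proof (induction p arbitrary: e)
    case (Eq s t)
    then show ?case
      using inj_on_eq_iff[OF inj, of "term_val G e s" "term_val G e t"]
        term_val_closed[OF assms(1) Eq] val[OF Eq] by simp
  next
    case (Exi v p)
    have "sat H ((\<lambda>w. h (e w))(v := h a)) p \<longleftrightarrow> sat G (e(v := a)) p" if "a \<in> carrier G" for a
    proof -
      have "(\<lambda>w. h (e w))(v := h a) = (\<lambda>w. h ((e(v := a)) w))" by auto
      moreover have "range (e(v := a)) \<subseteq> carrier G" using Exi.prems that by auto
      ultimately show ?thesis using Exi.IH by metis
    qed
    then show ?case by (simp add: img[symmetric])
  qed auto
qed

lemma models_iso:
  assumes "group G" "group H" "G \<cong> H" "sentence p"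
  shows "models G p \<longleftrightarrow> models H p"
proof -
  obtain h where h: "h \<in> iso G H" using assms(3) by (auto simp: is_iso_def)
  let ?e = "\<lambda>_. \<one>\<^bsub>G\<^esub>"
  have e: "range ?e \<subseteq> carrier G" using assms(1) by (auto simp: group.is_monoid)
  moreover have "range (\<lambda>w. h (?e w)) \<subseteq> carrier H"
    using h e by (auto simp: iso_def hom_def)
  ultimately show ?thesis
    using models_sentence[OF assms(4) e] models_sentence[OF assms(4), of "\<lambda>w. h (?e w)" H]
      sat_iso[OF assms(1,2) h e, of p] by simp
qed

context
  fixes F :: "'i filter" and G :: "'i \<Rightarrow> ('a, 'b) monoid_scheme"
  assumes grp: "\<And>i. group (G i)"
begin

abbreviation (input) "ultra_seqs \<equiv> (\<Pi> i\<in>UNIV. carrier (G i))"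
abbreviation (input) "ultra_class f \<equiv> ultra_rel F G `` {f}"

lemma equiv_ultra_rel: "equiv ultra_seqs (ultra_rel F G)"
proof (rule equivI)
  show "ultra_rel F G \<subseteq> ultra_seqs \<times> ultra_seqs" by (auto simp: ultra_rel_def)
  show "refl_on ultra_seqs (ultra_rel F G)" by (auto simp: refl_on_def ultra_rel_def)
  show "sym (ultra_rel F G)"
    by (auto simp: sym_def ultra_rel_def elim: eventually_mono)
  show "trans (ultra_rel F G)"
    by (auto simp: trans_def ultra_rel_def elim: eventually_elim2)
qed

lemma ultra_class_eq_iff:
  "f \<in> ultra_seqs \<Longrightarrow> g \<in> ultra_seqs \<Longrightarrow> ultra_class f = ultra_class g \<longleftrightarrow> (\<forall>\<^sub>F i in F. f i = g i)"
  using eq_equiv_class_iff[OF equiv_ultra_rel, of f g] by (auto simp: ultra_rel_def)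

lemma carrier_ultraproduct: "carrier (ultraproduct F G) = (\<lambda>f. ultra_class f) ` ultra_seqs"
  by (auto simp: ultraproduct_def quotient_def)

lemma one_ultraproduct: "\<one>\<^bsub>ultraproduct F G\<^esub> = ultra_class (\<lambda>i. \<one>\<^bsub>G i\<^esub>)"
  by (simp add: ultraproduct_def)

lemma mult_ultraproduct:
  assumes "f \<in> ultra_seqs" "g \<in> ultra_seqs"
  shows "ultra_class f \<otimes>\<^bsub>ultraproduct F G\<^esub> ultra_class g = ultra_class (\<lambda>i. f i \<otimes>\<^bsub>G i\<^esub> g i)"
proof -
  have "congruent2 (ultra_rel F G) (ultra_rel F G) (\<lambda>x y. ultra_class (\<lambda>i. x i \<otimes>\<^bsub>G i\<^esub> y i))"
  proof (rule congruent2I')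
    fix x x' y y' assume *: "(x, x') \<in> ultra_rel F G" "(y, y') \<in> ultra_rel F G"
    have "(\<lambda>i. x i \<otimes>\<^bsub>G i\<^esub> y i) \<in> ultra_seqs" "(\<lambda>i. x' i \<otimes>\<^bsub>G i\<^esub> y' i) \<in> ultra_seqs"
      using * grp by (auto simp: ultra_rel_def Pi_iff group.is_monoid intro!: monoid.m_closed)
    moreover have "\<forall>\<^sub>F i in F. x i \<otimes>\<^bsub>G i\<^esub> y i = x' i \<otimes>\<^bsub>G i\<^esub> y' i"
      using * by (auto simp: ultra_rel_def elim: eventually_elim2)
    ultimately show "ultra_class (\<lambda>i. x i \<otimes>\<^bsub>G i\<^esub> y i) = ultra_class (\<lambda>i. x' i \<otimes>\<^bsub>G i\<^esub> y' i)"
      using ultra_class_eq_iff by blast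
  qed
  from UN_equiv_class2[OF equiv_ultra_rel equiv_ultra_rel this assms]
  show ?thesis by (simp add: ultraproduct_def)
qed

lemma group_ultraproduct: "group (ultraproduct F G)"
proof (rule groupI)
  note closed = group.is_monoid[OF grp] monoid.m_closed group.inv_closed[OF grp]
  note simps = carrier_ultraproduct mult_ultraproduct one_ultraproduct
  show "\<one>\<^bsub>ultraproduct F G\<^esub> \<in> carrier (ultraproduct F G)"
    using grp by (auto simp: simps group.is_monoid intro!: imageI)
  show "x \<otimes>\<^bsub>ultraproduct F G\<^esub> y \<in> carrier (ultraproduct F G)"
    if "x \<in> carrier (ultraproduct F G)" "y \<in> carrier (ultraproduct F G)" for x y
  proof -
    from that obtain f g where fg: "f \<in> ultra_seqs" "g \<in> ultra_seqs" "x = ultra_class f" "y = ultra_class g"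
      by (auto simp: carrier_ultraproduct)
    have "(\<lambda>i. f i \<otimes>\<^bsub>G i\<^esub> g i) \<in> ultra_seqs" using fg(1,2) by (auto intro!: closed)
    then show ?thesis using fg by (auto simp: simps)
  qed
  show "x \<otimes>\<^bsub>ultraproduct F G\<^esub> y \<otimes>\<^bsub>ultraproduct F G\<^esub> z =
        x \<otimes>\<^bsub>ultraproduct F G\<^esub> (y \<otimes>\<^bsub>ultraproduct F G\<^esub> z)"
    if "x \<in> carrier (ultraproduct F G)" "y \<in> carrier (ultraproduct F G)"
      "z \<in> carrier (ultraproduct F G)" for x y z
  proof -
    from that obtain f g h where fg: "f \<in> ultra_seqs" "g \<in> ultra_seqs" "h \<in> ultra_seqs"
      "x = ultra_class f" "y = ultra_class g" "z = ultra_class h"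
      by (auto simp: carrier_ultraproduct)
    have "(\<lambda>i. f i \<otimes>\<^bsub>G i\<^esub> g i) \<in> ultra_seqs" "(\<lambda>i. g i \<otimes>\<^bsub>G i\<^esub> h i) \<in> ultra_seqs"
      using fg(1-3) by (auto intro!: closed)
    moreover have "f i \<otimes>\<^bsub>G i\<^esub> g i \<otimes>\<^bsub>G i\<^esub> h i = f i \<otimes>\<^bsub>G i\<^esub> (g i \<otimes>\<^bsub>G i\<^esub> h i)" for i
      using fg(1-3) by (intro monoid.m_assoc group.is_monoid grp) auto
    ultimately show ?thesis using fg by (simp add: simps)
  qed
  show "\<one>\<^bsub>ultraproduct F G\<^esub> \<otimes>\<^bsub>ultraproduct F G\<^esub> x = x" if "x \<in> carrier (ultraproduct F G)" for x
  proof -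
    from that obtain f where f: "f \<in> ultra_seqs" "x = ultra_class f" by (auto simp: carrier_ultraproduct)
    have "(\<lambda>i. \<one>\<^bsub>G i\<^esub>) \<in> ultra_seqs" using grp by (auto simp: group.is_monoid)
    moreover have "\<one>\<^bsub>G i\<^esub> \<otimes>\<^bsub>G i\<^esub> f i = f i" for i
      using f(1) by (intro monoid.l_one group.is_monoid grp) auto
    ultimately show ?thesis using f by (simp add: simps)
  qed
  show "\<exists>y\<in>carrier (ultraproduct F G). y \<otimes>\<^bsub>ultraproduct F G\<^esub> x = \<one>\<^bsub>ultraproduct F G\<^esub>"
    if "x \<in> carrier (ultraproduct F G)" for x
  proof -
    from that obtain f where f: "f \<in> ultra_seqs" "x = ultra_class f" by (auto simp: carrier_ultraproduct)
    have *: "(\<lambda>i. inv\<^bsub>G i\<^esub> f i) \<in> ultra_seqs" using f(1) by (auto intro!: closed)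
    moreover have "inv\<^bsub>G i\<^esub> f i \<otimes>\<^bsub>G i\<^esub> f i = \<one>\<^bsub>G i\<^esub>" for i
      using f(1) by (intro group.l_inv grp) auto
    ultimately have "ultra_class (\<lambda>i. inv\<^bsub>G i\<^esub> f i) \<otimes>\<^bsub>ultraproduct F G\<^esub> x = \<one>\<^bsub>ultraproduct F G\<^esub>"
      using f by (simp add: simps)
    then show ?thesis using * by (auto simp: carrier_ultraproduct)
  qed
qed

lemma inv_ultraproduct:
  assumes "f \<in> ultra_seqs"
  shows "inv\<^bsub>ultraproduct F G\<^esub> (ultra_class f) = ultra_class (\<lambda>i. inv\<^bsub>G i\<^esub> f i)"
proof -
  have *: "(\<lambda>i. inv\<^bsub>G i\<^esub> f i) \<in> ultra_seqs" using assms by (auto intro!: group.inv_closed[OF grp])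
  moreover have "inv\<^bsub>G i\<^esub> f i \<otimes>\<^bsub>G i\<^esub> f i = \<one>\<^bsub>G i\<^esub>" for i
    using assms by (intro group.l_inv grp) auto
  ultimately have "ultra_class (\<lambda>i. inv\<^bsub>G i\<^esub> f i) \<otimes>\<^bsub>ultraproduct F G\<^esub> ultra_class f = \<one>\<^bsub>ultraproduct F G\<^esub>"
    using assms by (simp add: mult_ultraproduct one_ultraproduct)
  then show ?thesis
    using * assms by (intro group.inv_equality[OF group_ultraproduct]) (auto simp: carrier_ultraproduct)
qed

theorem Los:
  assumes "ultrafilter F" "range e \<subseteq> ultra_seqs"
  shows "sat (ultraproduct F G) (\<lambda>v. ultra_class (e v)) p \<longleftrightarrow> (\<forall>\<^sub>F i in F. sat (G i) (\<lambda>v. e v i) p)"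
  using assms(2)
proof (induction p arbitrary: e)
  case (Eq s t)
  have closed: "(\<lambda>i. term_val (G i) (\<lambda>v. e v i) t) \<in> ultra_seqs" for t
    using Eq by (auto intro!: term_val_closed grp)
  have "term_val (ultraproduct F G) (\<lambda>v. ultra_class (e v)) t = ultra_class (\<lambda>i. term_val (G i) (\<lambda>v. e v i) t)" for t
    by (induction t) (simp_all add: closed one_ultraproduct mult_ultraproduct inv_ultraproduct)
  then show ?case using ultra_class_eq_iff[OF closed closed] by simp
next
  case (Neg p)
  have "eventually (\<lambda>i. \<not> Q i) F \<longleftrightarrow> \<not> eventually Q F" for Q
  proof
    assume "eventually (\<lambda>i. \<not> Q i) F"
    then show "\<not> eventually Q F"
      using assms(1) eventually_conj[of Q F "\<lambda>i. \<not> Q i"]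
      by (auto simp: ultrafilter_def trivial_limit_def)
  qed (use assms(1) in \<open>auto simp: ultrafilter_def\<close>)
  then show ?case using Neg by simp
next
  case (Conj p q)
  then show ?case by (simp add: eventually_conj_iff)
next
  case (Exi v p)
  have *: "sat (ultraproduct F G) ((\<lambda>w. ultra_class (e w))(v := ultra_class f)) p \<longleftrightarrow>
        (\<forall>\<^sub>F i in F. sat (G i) ((\<lambda>w. e w i)(v := f i)) p)" if "f \<in> ultra_seqs" for f
  proof -
    have "range (e(v := f)) \<subseteq> ultra_seqs" using Exi.prems that by auto
    moreover have "(\<lambda>w. ultra_class ((e(v := f)) w)) = (\<lambda>w. ultra_class (e w))(v := ultra_class f)"
      "(\<lambda>w. (e(v := f)) w i) = (\<lambda>w. e w i)(v := f i)" for i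
      by (simp_all add: fun_eq_iff)
    ultimately show ?thesis using Exi.IH[of "e(v := f)"] by (simp only:)
  qed
  have "(\<exists>f\<in>ultra_seqs. \<forall>\<^sub>F i in F. Q i (f i)) \<longleftrightarrow> (\<forall>\<^sub>F i in F. \<exists>a\<in>carrier (G i). Q i a)" for Q
  proof
    assume "\<exists>f\<in>ultra_seqs. \<forall>\<^sub>F i in F. Q i (f i)"
    then show "\<forall>\<^sub>F i in F. \<exists>a\<in>carrier (G i). Q i a" by (auto elim!: eventually_mono)
  next
    define f where "f i = (if \<exists>a\<in>carrier (G i). Q i a
      then SOME a. a \<in> carrier (G i) \<and> Q i a else \<one>\<^bsub>G i\<^esub>)" for i
    have f: "f i \<in> carrier (G i) \<and> ((\<exists>a\<in>carrier (G i). Q i a) \<longrightarrow> Q i (f i))" for i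
      using someI_ex[of "\<lambda>a. a \<in> carrier (G i) \<and> Q i a"] group.is_monoid[OF grp[of i]]
      unfolding f_def by (auto simp: Bex_def)
    assume "\<forall>\<^sub>F i in F. \<exists>a\<in>carrier (G i). Q i a"
    then have "\<forall>\<^sub>F i in F. Q i (f i)" by (rule eventually_mono) (use f in blast)
    then show "\<exists>f\<in>ultra_seqs. \<forall>\<^sub>F i in F. Q i (f i)" using f by blast
  qed
  then show ?case using * by (simp add: carrier_ultraproduct)
qed

corollary models_ultraproduct_iff:
  assumes "ultrafilter F" "sentence p"
  shows "models (ultraproduct F G) p \<longleftrightarrow> (\<forall>\<^sub>F i in F. models (G i) p)"
proof -
  let ?e = "\<lambda>_::nat. \<lambda>i. \<one>\<^bsub>G i\<^esub>"
  have e: "range ?e \<subseteq> ultra_seqs" using grp by (auto simp: group.is_monoid)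
  have "models (G i) p \<longleftrightarrow> sat (G i) (\<lambda>v. ?e v i) p" for i
    by (rule models_sentence[OF assms(2)]) (use grp in \<open>auto simp: group.is_monoid\<close>)
  moreover have "models (ultraproduct F G) p \<longleftrightarrow> sat (ultraproduct F G) (\<lambda>v. ultra_class (?e v)) p"
    by (rule models_sentence[OF assms(2)]) (use e in \<open>auto simp: carrier_ultraproduct\<close>)
  ultimately show ?thesis using Los[OF assms(1) e] by simp
qed

end

lemma finite_cyclic_iso:
  fixes G (structure)
  assumes "group G" "cyclic_group G" "finite (carrier G)"
  shows "integer_mod_group (order G) \<cong> G"
proof -
  interpret group G by fact
  obtain x where x: "x \<in> carrier G" and gen: "carrier G = range (\<lambda>k::int. x [^] k)"
    using assms(2) cyclic_group by auto
  have pos: "order G > 0" using assms(3) by (simp add: order_gt_0_iff_finite)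
  have period: "x [^] (k mod int (order G)) = x [^] k" for k :: int
  proof -
    have "x [^] int (order G) = \<one>"
      using x pow_order_eq_1 by (simp add: int_pow_int)
    moreover have "x [^] k =
        (x [^] int (order G)) [^] (k div int (order G)) \<otimes> x [^] (k mod int (order G))"
      using x by (simp add: int_pow_pow int_pow_mult[symmetric])
    ultimately show ?thesis using x by simp
  qed
  let ?Z = "integer_mod_group (order G)" and ?h = "\<lambda>k::int. x [^] k"
  have car: "carrier ?Z = {0..<int (order G)}"
    using pos by (simp add: carrier_integer_mod_group)
  have "?h ` carrier ?Z = carrier G"
  proof
    show "?h ` carrier ?Z \<subseteq> carrier G" using x by auto
    show "carrier G \<subseteq> ?h ` carrier ?Z"
    proof
      fix y assume "y \<in> carrier G"
      then obtain k where "y = x [^] (k::int)" using gen by auto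
      then have "y = ?h (k mod int (order G))" using period by simp
      moreover have "k mod int (order G) \<in> carrier ?Z" using pos car by simp
      ultimately show "y \<in> ?h ` carrier ?Z" by blast
    qed
  qed
  moreover from this have "inj_on ?h (carrier ?Z)"
    using assms(3) by (intro eq_card_imp_inj_on) (simp_all add: car[unfolded order_def] order_def)
  moreover have "?h \<in> hom ?Z G"
    using x by (auto simp: hom_def mult_integer_mod_group period int_pow_mult)
  ultimately show ?thesis by (auto simp: is_iso_def iso_def bij_betw_def)
qed

text \<open>
  Push the ultrafilter forward along \<open>i \<mapsto> |C\<^sub>i|\<close>: by the theorem of Los, the ultraproduct
  of the \<open>C\<^sub>i\<close> is elementarily equivalent to the resulting ultraproduct of the groups of integers
  modulo \<open>n\<close>.
\<close>

theorem pseudofinite_cyclicI: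
  fixes F :: "'i filter" and C :: "'i \<Rightarrow> ('c, 'd) monoid_scheme"
  assumes "group A" and F: "ultrafilter F"
    and C: "\<And>i. group (C i) \<and> cyclic_group (C i) \<and> finite (carrier (C i))"
    and equiv: "elementarily_equivalent A (ultraproduct F C)"
  shows "pseudofinite_cyclic A"
proof -
  define U where "U = filtermap (\<lambda>i. order (C i)) F"
  define Z where "Z n = integer_mod_group (if n = 0 then 1 else n)" for n
  have U: "ultrafilter U"
    using F by (auto simp: ultrafilter_def U_def eventually_filtermap filtermap_bot_iff)
  have Z: "group (Z n)" "cyclic_group (Z n)" "finite (carrier (Z n))" for n
  proof -
    show "group (Z n)" by (simp add: Z_def)
    have "(\<lambda>k. k mod int (if n = 0 then 1 else n)) \<in> epi integer_group (Z n)"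
      by (auto simp: epi_def hom_def Z_def mult_integer_mod_group carrier_integer_mod_group
            mod_simps image_iff intro: bexI[where x = "_ :: int"] split: if_splits)
         (metis mod_pos_pos_trivial)+
    then show "cyclic_group (Z n)"
      using group.cyclic_group_epimorphic_image[OF group_integer_group] \<open>group (Z n)\<close> by auto
    show "finite (carrier (Z n))" by (simp add: Z_def carrier_integer_mod_group)
  qed
  have "models (ultraproduct F C) p \<longleftrightarrow> models (ultraproduct U Z) p" if p: "sentence p" for p
  proof -
    have "models (Z (order (C i))) p \<longleftrightarrow> models (C i) p" for i
    proof -
      interpret group "C i" using C by blast
      have "order (C i) > 0" using C by (simp add: order_gt_0_iff_finite)
      then have "Z (order (C i)) \<cong> C i" using finite_cyclic_iso[of "C i"] C by (simp add: Z_def)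
      then show ?thesis using models_iso[OF Z(1) _ _ p] C by blast
    qed
    then show ?thesis
      using C Z F U p
      by (simp add: models_ultraproduct_iff) (simp add: U_def eventually_filtermap)
  qed
  then have "elementarily_equivalent A (ultraproduct U Z)"
    using equiv by (simp add: elementarily_equivalent_def)
  then show ?thesis
    unfolding pseudofinite_cyclic_def using assms(1) U Z by blast
qed

end

theory Submission
  imports Defs "HOL-Computational_Algebra.Primes" "HOL-Algebra.Polynomial_Divisibility"
begin

text \<open>
  Let \<open>A = ker \<phi>\<close>. The \<open>n\<close>-torsion of \<open>K\<^sup>\<times>\<close> is finite cyclic, so the snake lemma for multiplication by \<open>n\<close>
  on \<open>1 \<rightarrow> A \<rightarrow> K\<^sup>\<times> \<rightarrow> K\<^sup>\<times> \<rightarrow> 1\<close> shows that \<open>A[n]\<close> and \<open>A/A\<^sup>n\<close> are cyclic of the same finite order.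
  An Ehrenfeucht-Fraisse argument shows that such an \<open>A\<close>, if infinite, satisfies the same sentences up to
  any given complexity as a suitable finite cyclic group: positions are compared by the bounded
  linear equations they satisfy and by the divisibility of their combinations by divisors of a
  modulus \<open>\<Lambda>\<close>, after naming a generator \<open>g\<close> of \<open>A/A\<^sup>\<Lambda>\<close> and a generator \<open>t\<close> of \<open>A[\<Lambda>]\<close>. If these
  groups have order \<open>q\<close> and \<open>t \<in> g\<^sup>c A\<^sup>\<Lambda>\<close>, the cyclic group is the one of order \<open>q h\<close>, where \<open>h\<close> is large,
  congruent to \<open>c\<close> modulo \<open>q\<close> and coprime to \<open>\<Lambda> / q\<close>. A finite \<open>A\<close> is itself cyclic.
\<close>

\<comment> \<open>It would shadow \<open>Multiplicative_Group.mult_of\<close>.\<close>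
hide_const (open) Ring_Divisibility.mult_of

section \<open>Bounded combinations and the back-and-forth step\<close>

text \<open>Szmielew's quantifier elimination for abelian groups predicts what must be matched:
  linear equations and divisibility conditions. The obstacle is that every element of a finite group
  satisfies equations with large coefficients, which elements of an infinite \<open>A\<close> need
  not. Hence equations are compared for bounded coefficients only, with a bound that shrinks at each
  quantifier. The torsion generator escapes the bound because it has the same finite order on both
  sides. The common order \<open>q\<close> does not yet single out a companion: sentences also see
  the class of \<open>t\<close> modulo \<Lambda>-th powers, which \<open>c\<close> records. In the
  integers modulo \<open>q * h\<close>, with generator 1, the torsion is generated by
  \<open>h\<close>, whose class is \<open>h\<close> modulo \<open>q\<close>; whence the congruence.
  Coprimality to \<Lambda> / q makes \<open>q\<close> the gcd of \<Lambda> and \<open>q * h\<close>.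
  The two demands are compatible because \<open>t\<close> has order exactly
  \<open>q\<close>.\<close>

primrec comb :: "('a, 'b) monoid_scheme \<Rightarrow> (nat \<Rightarrow> 'a) \<Rightarrow> (nat \<Rightarrow> int) \<Rightarrow> nat \<Rightarrow> 'a" where
  "comb G e m 0 = \<one>\<^bsub>G\<^esub>"
| "comb G e m (Suc k) = comb G e m k \<otimes>\<^bsub>G\<^esub> e k [^]\<^bsub>G\<^esub> m k"

definition powers :: "('a, 'b) monoid_scheme \<Rightarrow> int \<Rightarrow> 'a set" where
  "powers G d = (\<lambda>x. x [^]\<^bsub>G\<^esub> d) ` carrier G"

context comm_group
begin

lemma comb_closed [simp]: "range e \<subseteq> carrier G \<Longrightarrow> comb G e m k \<in> carrier G"
  by (induction k) (auto intro!: m_closed int_pow_closed)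

lemma comb_add:
  assumes "range e \<subseteq> carrier G"
  shows "comb G e (\<lambda>i. m i + m' i) k = comb G e m k \<otimes> comb G e m' k"
proof (induction k)
  case (Suc k)
  have "e k \<in> carrier G" using assms by auto
  then show ?case using Suc comb_closed[OF assms] by (simp add: int_pow_mult m_ac)
qed simp

lemma comb_scale:
  assumes "range e \<subseteq> carrier G"
  shows "comb G e (\<lambda>i. c * m i) k = comb G e m k [^] c"
proof (induction k)
  case (Suc k)
  have "e k \<in> carrier G" using assms by auto
  then show ?case using Suc comb_closed[OF assms] by (simp add: int_pow_pow int_pow_distrib mult.commute)
qed simp

lemma comb_uminus:
  assumes "range e \<subseteq> carrier G"
  shows "comb G e (\<lambda>i. - m i) k = inv (comb G e m k)"
  using comb_scale[OF assms, of "-1" m k] comb_closed[OF assms] by (simp add: int_pow_neg)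

lemma comb_cong:
  "(\<And>i. i < k \<Longrightarrow> e i [^] m i = e' i [^] m' i) \<Longrightarrow> comb G e m k = comb G e' m' k"
  by (induction k) auto

lemma comb_upd:
  assumes "range e \<subseteq> carrier G" "a \<in> carrier G" "v < k"
  shows "comb G (e(v := a)) m k = comb G e (m(v := 0)) k \<otimes> a [^] m v"
  using assms(3)
proof (induction k)
  case (Suc k)
  have e: "e k \<in> carrier G" using assms by auto
  show ?case
  proof (cases "v = k")
    case True
    then have "comb G (e(v := a)) m k = comb G e (m(v := 0)) k"
      by (intro comb_cong) auto
    then show ?thesis using True assms
      by (simp del: fun_upd_apply add: fun_upd_same)
  next
    case False
    then show ?thesis using Suc e assms by (simp add: m_ac)
  qed
qed simp

lemma comb_single:
  assumes "range e \<subseteq> carrier G" "j < k"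
  shows "comb G e (\<lambda>i. if i = j then c else 0) k = e j [^] c"
  using assms(2)
proof (induction k)
  case (Suc k)
  have e: "e j \<in> carrier G" using assms by auto
  show ?case
  proof (cases "j = k")
    case True
    have "comb G e (\<lambda>i. if i = j then c else 0) k = comb G e (\<lambda>i. 0) k"
      using True by (intro comb_cong) auto
    also have "\<dots> = \<one>" by (induction k) auto
    finally show ?thesis using True e by simp
  qed (use Suc e in simp)
qed simp

lemma powers_subset: "powers G d \<subseteq> carrier G"
  by (auto simp: powers_def)

lemma powers_mult:
  assumes "x \<in> powers G d" "y \<in> powers G d"
  shows "x \<otimes> y \<in> powers G d"
proof -
  obtain x' y' where "x' \<in> carrier G" "y' \<in> carrier G" "x = x' [^] d" "y = y' [^] d"
    using assms by (auto simp: powers_def)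
  then show ?thesis
    unfolding powers_def by (intro image_eqI[of _ _ "x' \<otimes> y'"]) (simp_all add: int_pow_distrib)
qed

lemma powers_int_pow:
  assumes "x \<in> powers G d"
  shows "x [^] (c::int) \<in> powers G d"
proof -
  obtain x' where "x' \<in> carrier G" "x = x' [^] d" using assms by (auto simp: powers_def)
  then show ?thesis
    unfolding powers_def by (intro image_eqI[of _ _ "x' [^] c"]) (simp_all add: int_pow_pow mult.commute)
qed

lemma powers_inv: "x \<in> powers G d \<Longrightarrow> inv x \<in> powers G d"
  using powers_int_pow[of x d "-1"] powers_subset[of d] by (auto simp: int_pow_neg)

lemma powers_mult_iff:
  assumes "x \<in> carrier G" "y \<in> powers G d"
  shows "x \<otimes> y \<in> powers G d \<longleftrightarrow> x \<in> powers G d"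
proof
  assume "x \<otimes> y \<in> powers G d"
  then have "(x \<otimes> y) \<otimes> inv y \<in> powers G d" using assms powers_mult powers_inv by blast
  moreover have "y \<in> carrier G" using assms powers_subset by blast
  ultimately show "x \<in> powers G d" using assms by (simp add: m_assoc)
qed (use assms powers_mult in blast)

lemma int_pow_in_powers:
  assumes "d dvd k" "x \<in> carrier G"
  shows "x [^] (k::int) \<in> powers G d"
proof -
  obtain c where "k = d * c" using assms(1) by (auto simp: dvd_def)
  then show ?thesis
    unfolding powers_def using assms(2)
    by (intro image_eqI[of _ _ "x [^] c"]) (simp_all add: int_pow_pow mult.commute)
qed

lemma powers_antimono: "d dvd d' \<Longrightarrow> powers G d' \<subseteq> powers G d"
  using int_pow_in_powers[of d d'] by (simp add: powers_def[of G d'] image_subset_iff)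

end

text \<open>Otherwise \<open>K + 2\<close> splits off the last two factors, out of reach of the
  lemmas on whole combinations.\<close>

declare comb.simps(2) [simp del]

text \<open>
  Environments are read as follows: the indices below \<open>K\<close> are the variables of formulas, index \<open>K\<close>
  holds a generator modulo \<open>\<Lambda>\<close>-th powers, and index \<open>K + 1\<close> a generator of the \<open>\<Lambda>\<close>-torsion, whose
  coefficient is not bounded.
\<close>

definition coeffs_le :: "nat \<Rightarrow> int \<Rightarrow> (nat \<Rightarrow> int) \<Rightarrow> bool" where
  "coeffs_le K N m \<longleftrightarrow> (\<forall>i\<le>K. \<bar>m i\<bar> \<le> N)"

text \<open>The second clause puts no bound on \<open>m\<close>: modulo \<open>d\<close>-th powers
  only the residues of \<open>m\<close> modulo \<open>d\<close> count. \<open>L\<close> is separate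
  from the modulus of the frames because it shrinks at each quantifier while the frames
  stay.\<close>

definition similar :: "nat \<Rightarrow> int \<Rightarrow> int \<Rightarrow> ('a, 'b) monoid_scheme \<Rightarrow> (nat \<Rightarrow> 'a) \<Rightarrow>
    ('c, 'd) monoid_scheme \<Rightarrow> (nat \<Rightarrow> 'c) \<Rightarrow> bool" where
  "similar K N L G e H f \<longleftrightarrow>
     (\<forall>m. coeffs_le K N m \<longrightarrow> (comb G e m (K + 2) = \<one>\<^bsub>G\<^esub> \<longleftrightarrow> comb H f m (K + 2) = \<one>\<^bsub>H\<^esub>)) \<and>
     (\<forall>m d. d dvd L \<longrightarrow> (comb G e m (K + 2) \<in> powers G d \<longleftrightarrow> comb H f m (K + 2) \<in> powers H d))"

text \<open>Combinations can thus name every coset of the \<Lambda>-th powers and every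
  \<Lambda>-torsion element. The order of the torsion generator is compared by
  \<open>similar\<close>, through the unbounded coefficient.\<close>

definition framed :: "nat \<Rightarrow> int \<Rightarrow> ('a, 'b) monoid_scheme \<Rightarrow> (nat \<Rightarrow> 'a) \<Rightarrow> bool" where
  "framed K \<Lambda> G e \<longleftrightarrow> comm_group G \<and> \<Lambda> > 0 \<and> range e \<subseteq> carrier G \<and>
     (\<forall>x\<in>carrier G. \<exists>j::int. \<exists>y\<in>carrier G. x = e K [^]\<^bsub>G\<^esub> j \<otimes>\<^bsub>G\<^esub> y [^]\<^bsub>G\<^esub> \<Lambda>) \<and>
     e (K + 1) [^]\<^bsub>G\<^esub> \<Lambda> = \<one>\<^bsub>G\<^esub> \<and>
     (\<forall>x\<in>carrier G. x [^]\<^bsub>G\<^esub> \<Lambda> = \<one>\<^bsub>G\<^esub> \<longrightarrow> (\<exists>i::int. x = e (K + 1) [^]\<^bsub>G\<^esub> i))"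

text \<open>Room for a generic element: at most \<open>(2 * N + 1) ^ (K + 1) * \<Lambda>\<close>
  combinations occur, as the last coefficient counts modulo \<Lambda>; each is paired with at most
  \<open>N\<close> exponents, and each resulting equation has at most \<Lambda> solutions. The
  factor \<open>N\<close> is rounded up to \<open>2 * N + 1\<close>.\<close>

definition large :: "nat \<Rightarrow> int \<Rightarrow> int \<Rightarrow> ('a, 'b) monoid_scheme \<Rightarrow> bool" where
  "large K N \<Lambda> G \<longleftrightarrow>
     (finite (carrier G) \<longrightarrow> (2 * N + 1) ^ (K + 2) * \<Lambda>\<^sup>2 < int (card (carrier G)))"

lemma coeffs_le_mono: "coeffs_le K N m \<Longrightarrow> N \<le> N' \<Longrightarrow> coeffs_le K N' m"
  by (auto simp: coeffs_le_def intro: order_trans)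

lemma similar_sym: "similar K N L G e H f \<Longrightarrow> similar K N L H f G e"
  by (auto simp: similar_def)

lemma similar_mono:
  "similar K N L G e H f \<Longrightarrow> N' \<le> N \<Longrightarrow> L' dvd L \<Longrightarrow> similar K N' L' G e H f"
  unfolding similar_def by (meson coeffs_le_mono dvd_trans)

lemma large_mono:
  assumes "large K N \<Lambda> G" "0 \<le> N'" "N' \<le> N"
  shows "large K N' \<Lambda> G"
proof -
  have "(2 * N' + 1) ^ (K + 2) * \<Lambda>\<^sup>2 \<le> (2 * N + 1) ^ (K + 2) * \<Lambda>\<^sup>2"
    using assms by (intro mult_right_mono power_mono) auto
  then show ?thesis using assms(1) by (auto simp: large_def)
qed

lemma framed_upd:
  "framed K \<Lambda> G e \<Longrightarrow> v < K \<Longrightarrow> a \<in> carrier G \<Longrightarrow> framed K \<Lambda> G (e(v := a))"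
  by (auto simp: framed_def)

section \<open>Descent, coefficient bounds and root counts for the back-and-forth step\<close>

text \<open>Whenever a smaller exponent occurs one level up, pass to it. Exponents decrease at each
  passage, so at most \<open>r\<close> passages occur; this bounds the level reached.\<close>

lemma stable_least_exponent:
  fixes P :: "nat \<Rightarrow> nat \<Rightarrow> bool"
  assumes "P j r"
  shows "\<exists>j' r'. j' \<le> j + r \<and> r' \<le> r \<and> P j' r' \<and> (\<forall>u<r'. \<not> P (Suc j') u)"
  using assms
proof (induction r arbitrary: j rule: less_induct)
  case (less r)
  show ?case
  proof (cases "\<exists>u<r. P (Suc j) u")
    case True
    then obtain u where u: "u < r" "P (Suc j) u" by blast
    obtain j' r' where "j' \<le> Suc j + u" "r' \<le> u" "P j' r'" "\<forall>u<r'. \<not> P (Suc j') u"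
      using less.IH[OF u] by blast
    then show ?thesis using u(1) by (intro exI[of _ j'] exI[of _ r']) auto
  next
    case False
    then show ?thesis using less.prems by (intro exI[of _ j] exI[of _ r]) auto
  qed
qed

text \<open>If \<open>a ^ r\<close> is a combination with coefficients up to \<open>B\<close>,
  dividing an exponent of \<open>a\<close> by \<open>r\<close> adds that combination at most
  \<open>N\<close> times to coefficients up to \<open>N\<close>: hence
  \<open>N * B + N\<close>.\<close>

primrec combination_bound :: "int \<Rightarrow> nat \<Rightarrow> int" where
  "combination_bound N 0 = N"
| "combination_bound N (Suc j) = N * combination_bound N j + N"

text \<open>Level \<open>nat N\<close> suffices because the descent starts at level 0 with an
  exponent up to \<open>N\<close>. The first two summands bound the coefficients
  \<open>r * w + u * s\<close> of an equation raised to the \<open>r\<close>-th power; the last one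
  brings the remaining coefficient bounds below the total.\<close>

definition step_bound :: "int \<Rightarrow> int" where
  "step_bound N = N * (N * combination_bound N (nat N) + N) + N * combination_bound N (nat N) + N"

lemma combination_bound_mono:
  assumes "N \<ge> 1" "i \<le> j"
  shows "combination_bound N i \<le> combination_bound N j"
proof -
  have pos: "combination_bound N k \<ge> 0" for k using assms by (induction k) auto
  have "combination_bound N k \<le> combination_bound N (Suc k)" for k
    using mult_right_mono[OF assms(1) pos[of k]] assms(1) by simp
  then show ?thesis using assms(2) by (rule lift_Suc_mono_le)
qed

text \<open>If there is a solution, all of them form a coset of the \<open>k\<close>-torsion; as
  \<open>k\<close> divides \<Lambda>, this torsion lies in the powers of \<open>t\<close>, at most
  \<Lambda> in number.\<close>

lemma (in comm_group) finite_roots: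
  fixes t :: 'a and \<Lambda> k :: int
  assumes "\<Lambda> > 0" "k dvd \<Lambda>" "t \<in> carrier G" "t [^] \<Lambda> = \<one>" "z \<in> carrier G"
    and gen: "\<And>x. x \<in> carrier G \<Longrightarrow> x [^] \<Lambda> = \<one> \<Longrightarrow> \<exists>i::int. x = t [^] i"
  shows "finite {y \<in> carrier G. y [^] k = z}" "card {y \<in> carrier G. y [^] k = z} \<le> nat \<Lambda>"
proof -
  let ?S = "{y \<in> carrier G. y [^] k = z}"
  have "\<exists>f. ?S \<subseteq> f ` {0..<\<Lambda>}"
  proof (cases "?S = {}")
    case False
    then obtain y0 where y0: "y0 \<in> carrier G" "y0 [^] k = z" by auto
    have "?S \<subseteq> (\<lambda>i. y0 \<otimes> t [^] i) ` {0..<\<Lambda>}"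
    proof
      fix y assume "y \<in> ?S"
      then have y: "y \<in> carrier G" "y [^] k = z" by auto
      have "(inv y0 \<otimes> y) [^] k = \<one>" using y y0 assms(5) by (simp add: int_pow_distrib int_pow_inv)
      then have "(inv y0 \<otimes> y) [^] \<Lambda> = \<one>"
        using assms(2) y y0 by (auto simp: dvd_def simp flip: int_pow_pow)
      then obtain i :: int where i: "inv y0 \<otimes> y = t [^] i" using gen y y0 by blast
      have "t [^] i = t [^] (\<Lambda> * (i div \<Lambda>) + i mod \<Lambda>)" by simp
      also have "\<dots> = (t [^] \<Lambda>) [^] (i div \<Lambda>) \<otimes> t [^] (i mod \<Lambda>)"
        using assms(3) by (simp only: int_pow_mult int_pow_pow)
      finally have "t [^] i = t [^] (i mod \<Lambda>)" using assms by simp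
      then have "y = y0 \<otimes> t [^] (i mod \<Lambda>)"
        using i y y0 assms(3) by (metis inv_closed inv_solve_left int_pow_closed inv_inv)
      then show "y \<in> (\<lambda>i. y0 \<otimes> t [^] i) ` {0..<\<Lambda>}" using assms(1) by auto
    qed
    then show ?thesis by blast
  qed auto
  then obtain f where f: "?S \<subseteq> f ` {0..<\<Lambda>}" by blast
  then show "finite ?S" using finite_surj by blast
  have "card ?S \<le> card {0..<\<Lambda>}" using f surj_card_le by blast
  then show "card ?S \<le> nat \<Lambda>" by simp
qed

text \<open>Only boundedly many \<open>b\<close> satisfy a bounded equation, which leaves room for a generic choice in a large group.\<close>

lemma generic_element:
  assumes fr: "framed K \<Lambda> H f" and "large K N \<Lambda> H" and N: "N \<ge> 1"
    and x: "x \<in> carrier H" and L: "\<And>c. 1 \<le> c \<Longrightarrow> c \<le> N \<Longrightarrow> L * c dvd \<Lambda>"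
  shows "\<exists>y\<in>carrier H. \<forall>m c. coeffs_le K N m \<longrightarrow> 1 \<le> \<bar>c\<bar> \<longrightarrow> \<bar>c\<bar> \<le> N \<longrightarrow>
           comb H f m (K + 2) \<otimes>\<^bsub>H\<^esub> (x \<otimes>\<^bsub>H\<^esub> y [^]\<^bsub>H\<^esub> L) [^]\<^bsub>H\<^esub> c \<noteq> \<one>\<^bsub>H\<^esub>"
proof (rule ccontr)
  assume neg: "\<not> ?thesis"
  interpret H: comm_group H using fr by (simp add: framed_def)
  have \<Lambda>: "\<Lambda> > 0" and f: "range f \<subseteq> carrier H" and t1: "f (K + 1) [^]\<^bsub>H\<^esub> \<Lambda> = \<one>\<^bsub>H\<^esub>"
    and t2: "\<And>x. x \<in> carrier H \<Longrightarrow> x [^]\<^bsub>H\<^esub> \<Lambda> = \<one>\<^bsub>H\<^esub> \<Longrightarrow> \<exists>i::int. x = f (K + 1) [^]\<^bsub>H\<^esub> i"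
    using fr by (auto simp: framed_def)
  have fc: "f i \<in> carrier H" for i using f by auto
  define B where "B i = (if i = K + 1 then {0..<\<Lambda>} else {-N..N})" for i
  let ?I = "(PiE {..<K + 2} B) \<times> {1..N}"
  define S where "S = (\<lambda>(m, c). {y \<in> carrier H. y [^]\<^bsub>H\<^esub> (L * c) =
      inv\<^bsub>H\<^esub> (comb H f m (K + 2) \<otimes>\<^bsub>H\<^esub> x [^]\<^bsub>H\<^esub> c)})"
  have finB: "finite (PiE {..<K + 2} B)" by (intro finite_PiE) (auto simp: B_def)
  have "card (PiE {..<K + 2} B) = (\<Prod>i<K + 2. card (B i))" by (rule card_PiE) simp
  also have "\<dots> = nat (2 * N + 1) ^ (K + 1) * nat \<Lambda>"
  proof -
    have "(\<Prod>i<K + 2. card (B i)) = (\<Prod>i<K + 1. card (B i)) * card (B (K + 1))" by simp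
    moreover have "(\<Prod>i<K + 1. card (B i)) = (\<Prod>i<K + 1. nat (2 * N + 1))"
      using N by (intro prod.cong) (auto simp: B_def algebra_simps)
    ultimately show ?thesis by (simp add: B_def)
  qed
  finally have cardB: "card (PiE {..<K + 2} B) = nat (2 * N + 1) ^ (K + 1) * nat \<Lambda>" .
  have S: "finite (S p)" "card (S p) \<le> nat \<Lambda>" if "p \<in> ?I" for p
  proof -
    obtain m c where p: "p = (m, c)" "c \<in> {1..N}" using \<open>p \<in> ?I\<close> by auto
    have "inv\<^bsub>H\<^esub> (comb H f m (K + 2) \<otimes>\<^bsub>H\<^esub> x [^]\<^bsub>H\<^esub> c) \<in> carrier H" using x f by simp
    from H.finite_roots[OF \<Lambda> L fc t1 this t2] p
    show "finite (S p)" "card (S p) \<le> nat \<Lambda>" by (auto simp: S_def)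
  qed
  have "carrier H \<subseteq> (\<Union>p\<in>?I. S p)"
  proof
    fix y assume y: "y \<in> carrier H"
    then obtain m c where m: "coeffs_le K N m" "1 \<le> \<bar>c\<bar>" "\<bar>c\<bar> \<le> N"
      and eq: "comb H f m (K + 2) \<otimes>\<^bsub>H\<^esub> (x \<otimes>\<^bsub>H\<^esub> y [^]\<^bsub>H\<^esub> L) [^]\<^bsub>H\<^esub> c = \<one>\<^bsub>H\<^esub>"
      using neg by blast
    \<comment> \<open>The sign of \<open>c\<close> moves into the coefficients, so only exponents
      from 1 to \<open>N\<close> are counted.\<close>
    define m' where "m' i = sgn c * m i" for i
    define m'' where "m'' = restrict (\<lambda>i. if i = K + 1 then m' i mod \<Lambda> else m' i) {..<K + 2}"
    have c: "sgn c * c = \<bar>c\<bar>" by (simp add: sgn_if)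
    have "comb H f m' (K + 2) = comb H f m (K + 2) [^]\<^bsub>H\<^esub> sgn c"
      unfolding m'_def by (rule H.comb_scale[OF f])
    then have "comb H f m' (K + 2) \<otimes>\<^bsub>H\<^esub> (x \<otimes>\<^bsub>H\<^esub> y [^]\<^bsub>H\<^esub> L) [^]\<^bsub>H\<^esub> \<bar>c\<bar> =
        (comb H f m (K + 2) \<otimes>\<^bsub>H\<^esub> (x \<otimes>\<^bsub>H\<^esub> y [^]\<^bsub>H\<^esub> L) [^]\<^bsub>H\<^esub> c) [^]\<^bsub>H\<^esub> sgn c"
      using H.int_pow_distrib[of "comb H f m (K + 2)" "(x \<otimes>\<^bsub>H\<^esub> y [^]\<^bsub>H\<^esub> L) [^]\<^bsub>H\<^esub> c" "sgn c"]
        H.int_pow_pow[of "x \<otimes>\<^bsub>H\<^esub> y [^]\<^bsub>H\<^esub> L" c "sgn c"] x y f c by (simp add: mult.commute)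
    then have eq': "comb H f m' (K + 2) \<otimes>\<^bsub>H\<^esub> (x \<otimes>\<^bsub>H\<^esub> y [^]\<^bsub>H\<^esub> L) [^]\<^bsub>H\<^esub> \<bar>c\<bar> = \<one>\<^bsub>H\<^esub>"
      using eq by simp
    have tmod: "f (K + 1) [^]\<^bsub>H\<^esub> (k mod \<Lambda>) = f (K + 1) [^]\<^bsub>H\<^esub> k" for k
    proof -
      have "f (K + 1) [^]\<^bsub>H\<^esub> k = f (K + 1) [^]\<^bsub>H\<^esub> (\<Lambda> * (k div \<Lambda>) + k mod \<Lambda>)" by simp
      also have "\<dots> = (f (K + 1) [^]\<^bsub>H\<^esub> \<Lambda>) [^]\<^bsub>H\<^esub> (k div \<Lambda>) \<otimes>\<^bsub>H\<^esub> f (K + 1) [^]\<^bsub>H\<^esub> (k mod \<Lambda>)"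
        using fc by (simp only: H.int_pow_mult H.int_pow_pow)
      finally show ?thesis using t1 fc by simp
    qed
    have "comb H f m'' (K + 2) = comb H f m' (K + 2)"
      by (rule H.comb_cong) (use tmod in \<open>auto simp: m''_def\<close>)
    with eq' have "comb H f m'' (K + 2) \<otimes>\<^bsub>H\<^esub> x [^]\<^bsub>H\<^esub> \<bar>c\<bar> \<otimes>\<^bsub>H\<^esub> y [^]\<^bsub>H\<^esub> (L * \<bar>c\<bar>) = \<one>\<^bsub>H\<^esub>"
      using x y f by (simp add: H.int_pow_distrib H.int_pow_pow H.m_assoc)
    then have "y \<in> S (m'', \<bar>c\<bar>)"
      using x y f unfolding S_def
      by (simp, metis H.comb_closed H.int_pow_closed H.inv_equality H.m_closed H.m_comm)
    moreover have "\<bar>m' i\<bar> \<le> \<bar>m i\<bar>" for i by (simp add: m'_def abs_mult sgn_if)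
    then have "m'' \<in> PiE {..<K + 2} B"
      using m(1) \<Lambda> unfolding coeffs_le_def m''_def B_def
      by (auto simp: PiE_iff less_Suc_eq_le abs_le_iff) (smt (verit) le_SucE)+
    ultimately show "y \<in> (\<Union>p\<in>?I. S p)" using m by (intro UN_I[of "(m'', \<bar>c\<bar>)"]) auto
  qed
  moreover have finU: "finite (\<Union>p\<in>?I. S p)" using S(1) finB by auto
  ultimately have fin: "finite (carrier H)" and "card (carrier H) \<le> card (\<Union>p\<in>?I. S p)"
    by (auto intro: finite_subset card_mono)
  note this(2)
  also have "card (\<Union>p\<in>?I. S p) \<le> (\<Sum>p\<in>?I. card (S p))"
    by (rule card_UN_le) (use finB in auto)
  also have "\<dots> \<le> card ?I * nat \<Lambda>"
    using sum_bounded_above[of ?I "\<lambda>p. card (S p)" "nat \<Lambda>"] S(2) by simp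
  also have "\<dots> = nat (2 * N + 1) ^ (K + 1) * nat \<Lambda> * nat N * nat \<Lambda>"
    by (simp only: card_cartesian_product cardB) simp
  finally have "int (card (carrier H)) \<le> int (nat (2 * N + 1) ^ (K + 1) * nat \<Lambda> * nat N * nat \<Lambda>)"
    by (simp only: of_nat_le_iff)
  also have "\<dots> = (2 * N + 1) ^ (K + 1) * \<Lambda> * N * \<Lambda>" using N \<Lambda> by simp
  also have "\<dots> \<le> (2 * N + 1) ^ (K + 1) * \<Lambda> * (2 * N + 1) * \<Lambda>"
    using N \<Lambda> by (intro mult_right_mono mult_left_mono) auto
  also have "\<dots> = (2 * N + 1) ^ (K + 2) * \<Lambda>\<^sup>2" by (simp add: power2_eq_square)
  finally show False using assms(2) fin by (simp add: large_def)
qed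

text \<open>
  The answer to \<open>a = g\<^sup>j a'\<^sup>L'\<close> is sought in the form \<open>b = g\<^sup>j b'\<^sup>L'\<close>, which settles divisibility. If no
  small power of \<open>a\<close> is a bounded combination of the environment, \<open>b'\<close> is chosen generically. Otherwise
  let \<open>r\<close> be the least such exponent, for a bound large enough that a further enlargement does not
  decrease \<open>r\<close>; then every \<open>b\<close> whose \<open>r\<close>-th power is the corresponding combination works, because the
  \<open>r\<close>-torsion consists of combinations.
\<close>

lemma forth:
  assumes sim: "similar K N L G e H f"
    and frG: "framed K \<Lambda> G e" and frH: "framed K \<Lambda> H f"
    and N': "N' \<ge> 1" and N: "step_bound N' \<le> N"
    and L: "\<And>r. 1 \<le> r \<Longrightarrow> r \<le> N' \<Longrightarrow> L' * r dvd L" and L\<Lambda>: "L dvd \<Lambda>"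
    and large: "large K N' \<Lambda> H" and a: "a \<in> carrier G" and v: "v < K"
  shows "\<exists>b\<in>carrier H. similar K N' L' G (e(v := a)) H (f(v := b))"
proof -
  interpret G: comm_group G using frG by (simp add: framed_def)
  interpret H: comm_group H using frH by (simp add: framed_def)
  have e: "range e \<subseteq> carrier G" and f: "range f \<subseteq> carrier H"
    using frG frH by (auto simp: framed_def)
  have eK: "e i \<in> carrier G" and fK: "f i \<in> carrier H" for i using e f by auto
  let ?c = "\<lambda>m. comb G e m (K + 2)" and ?d = "\<lambda>m. comb H f m (K + 2)"
  note Gs = G.comb_closed[OF e] G.comb_add[OF e] G.comb_scale[OF e] G.comb_uminus[OF e]
  note Hs = H.comb_closed[OF f] H.comb_add[OF f] H.comb_scale[OF f] H.comb_uminus[OF f]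
  have vK: "v < K + 2" using v by simp
  have eqs: "?c m = \<one>\<^bsub>G\<^esub> \<longleftrightarrow> ?d m = \<one>\<^bsub>H\<^esub>" if "coeffs_le K N m" for m
    using sim that by (auto simp: similar_def)
  have divs: "?c m \<in> powers G d \<longleftrightarrow> ?d m \<in> powers H d" if "d dvd L" for m d
    using sim that by (auto simp: similar_def)
  have L'L: "L' dvd L" using L[of 1] N' by simp
  have L'\<Lambda>: "L' dvd \<Lambda>" using L'L L\<Lambda> by (rule dvd_trans)
  define Q where "Q = combination_bound N' (nat N')"
  have Q: "Q \<ge> 1" using combination_bound_mono[OF N', of 0 "nat N'"] N' by (simp add: Q_def)
  have N_eq: "N' * (N' * Q + N') + N' * Q + N' \<le> N" using N by (simp add: step_bound_def Q_def)
  have pos: "0 \<le> N' * Q" "0 \<le> N' * (N' * Q + N')" using N' Q by auto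
  have N'Q: "N' * Q + N' \<le> N" and N'N: "N' \<le> N" using pos N_eq by linarith+

  obtain j :: int and a' where a': "a' \<in> carrier G" "a = e K [^]\<^bsub>G\<^esub> j \<otimes>\<^bsub>G\<^esub> a' [^]\<^bsub>G\<^esub> L'"
  proof -
    obtain j :: int and y where y: "y \<in> carrier G" "a = e K [^]\<^bsub>G\<^esub> j \<otimes>\<^bsub>G\<^esub> y [^]\<^bsub>G\<^esub> \<Lambda>"
      using frG a by (auto simp: framed_def)
    have "y [^]\<^bsub>G\<^esub> \<Lambda> \<in> powers G L'" using L'\<Lambda> y(1) by (rule G.int_pow_in_powers)
    then show thesis using that y by (auto simp: powers_def)
  qed
  define mg where "mg k = (\<lambda>i. if i = K then k else 0 :: int)" for k
  have mg: "?c (mg k) = e K [^]\<^bsub>G\<^esub> k" "?d (mg k) = f K [^]\<^bsub>H\<^esub> k" for k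
    unfolding mg_def by (simp_all only: G.comb_single[OF e] H.comb_single[OF f])
  have upd: "comb G (e(v := a)) m (K + 2) = ?c (m(v := 0)) \<otimes>\<^bsub>G\<^esub> a [^]\<^bsub>G\<^esub> m v" for m
    by (rule G.comb_upd[OF e a vK])

  \<comment> \<open>Modulo \<open>d\<close>-th powers \<open>a\<close> and its answer are the same
    power of the frame generator, so the factor at \<open>v\<close> becomes an exponent
    \<open>j * m v\<close> at index \<open>K\<close>. It may be arbitrarily large, as the
    divisibility clause of \<open>similar\<close> permits.\<close>
  have sim_divs: "comb G (e(v := a)) m (K + 2) \<in> powers G d \<longleftrightarrow>
      comb H (f(v := f K [^]\<^bsub>H\<^esub> j \<otimes>\<^bsub>H\<^esub> b' [^]\<^bsub>H\<^esub> L')) m (K + 2) \<in> powers H d"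
    if b': "b' \<in> carrier H" and d: "d dvd L'" for m d b'
  proof -
    let ?b = "f K [^]\<^bsub>H\<^esub> j \<otimes>\<^bsub>H\<^esub> b' [^]\<^bsub>H\<^esub> L'" and ?m = "\<lambda>i. (m(v := 0)) i + mg (j * m v) i"
    have "comb G (e(v := a)) m (K + 2) = ?c ?m \<otimes>\<^bsub>G\<^esub> a' [^]\<^bsub>G\<^esub> (L' * m v)"
      unfolding upd using a' eK
      by (simp only: Gs mg G.int_pow_distrib G.int_pow_pow G.int_pow_closed G.m_assoc)
    moreover have "comb H (f(v := ?b)) m (K + 2) = ?d ?m \<otimes>\<^bsub>H\<^esub> b' [^]\<^bsub>H\<^esub> (L' * m v)"
      using H.comb_upd[OF f _ vK, of ?b m] b' fK
      by (simp only: Hs mg H.int_pow_distrib H.int_pow_pow H.int_pow_closed H.m_assoc H.m_closed)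
    moreover have "d dvd L' * m v" using d by simp
    ultimately show ?thesis
      using G.powers_mult_iff[of "?c ?m" _ d] H.powers_mult_iff[of "?d ?m" _ d]
        G.int_pow_in_powers a'(1) H.int_pow_in_powers b' divs[of d ?m] d L'L
      by (simp only: Gs(1) Hs(1)) (meson dvd_trans)
  qed
  have finish: ?thesis if b': "b' \<in> carrier H"
    and sim_eqs: "\<And>m. coeffs_le K N' m \<Longrightarrow> comb G (e(v := a)) m (K + 2) = \<one>\<^bsub>G\<^esub> \<longleftrightarrow>
      comb H (f(v := f K [^]\<^bsub>H\<^esub> j \<otimes>\<^bsub>H\<^esub> b' [^]\<^bsub>H\<^esub> L')) m (K + 2) = \<one>\<^bsub>H\<^esub>" for b'
    using b' sim_eqs sim_divs[OF b'] fK unfolding similar_def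
    by (intro bexI[of _ "f K [^]\<^bsub>H\<^esub> j \<otimes>\<^bsub>H\<^esub> b' [^]\<^bsub>H\<^esub> L'"]) auto

  define P where "P i r \<longleftrightarrow> 1 \<le> r \<and> int r \<le> N' \<and>
      (\<exists>m. coeffs_le K (combination_bound N' i) m \<and> a [^]\<^bsub>G\<^esub> int r = ?c m)" for i r
  show ?thesis
  proof (cases "\<exists>r. P 0 r")
    case False
    have generic: "?c m \<otimes>\<^bsub>G\<^esub> a [^]\<^bsub>G\<^esub> k \<noteq> \<one>\<^bsub>G\<^esub>" if "coeffs_le K N' m" "1 \<le> \<bar>k\<bar>" "\<bar>k\<bar> \<le> N'" for m k
    proof
      assume *: "?c m \<otimes>\<^bsub>G\<^esub> a [^]\<^bsub>G\<^esub> k = \<one>\<^bsub>G\<^esub>"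
      have "a [^]\<^bsub>G\<^esub> k = ?c (\<lambda>i. - m i)"
        using * a by (simp only: Gs) (metis G.comb_closed[OF e] G.int_pow_closed G.inv_equality G.m_comm)
      then have "a [^]\<^bsub>G\<^esub> (k * sgn k) = ?c (\<lambda>i. sgn k * - m i)"
        using a by (simp only: G.comb_scale[OF e] flip: G.int_pow_pow)
      moreover have "k * sgn k = int (nat \<bar>k\<bar>)" by (simp add: sgn_if)
      moreover have "coeffs_le K N' (\<lambda>i. sgn k * - m i)"
        using that(1) N' by (simp add: coeffs_le_def abs_mult sgn_if)
      ultimately have "P 0 (nat \<bar>k\<bar>)" using that unfolding P_def by (auto simp: combination_bound.simps(1))
      then show False using False by blast
    qed
    have "L' * c dvd \<Lambda>" if "1 \<le> c" "c \<le> N'" for c using L[OF that] L\<Lambda> by (rule dvd_trans)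
    from generic_element[OF frH large N' H.int_pow_closed[OF fK[of K], of j] this]
    obtain b' where b': "b' \<in> carrier H" and gb: "\<And>m k. coeffs_le K N' m \<Longrightarrow> 1 \<le> \<bar>k\<bar> \<Longrightarrow> \<bar>k\<bar> \<le> N' \<Longrightarrow>
        ?d m \<otimes>\<^bsub>H\<^esub> (f K [^]\<^bsub>H\<^esub> j \<otimes>\<^bsub>H\<^esub> b' [^]\<^bsub>H\<^esub> L') [^]\<^bsub>H\<^esub> k \<noteq> \<one>\<^bsub>H\<^esub>" by blast
    show ?thesis
    proof (rule finish[OF b'])
      fix m assume m: "coeffs_le K N' m"
      let ?b = "f K [^]\<^bsub>H\<^esub> j \<otimes>\<^bsub>H\<^esub> b' [^]\<^bsub>H\<^esub> L'"
      have b: "?b \<in> carrier H" using b' fK by simp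
      have m0: "coeffs_le K N' (m(v := 0))" using m N' by (simp add: coeffs_le_def)
      have "\<bar>m v\<bar> \<le> N'" using m v by (simp add: coeffs_le_def)
      then show "comb G (e(v := a)) m (K + 2) = \<one>\<^bsub>G\<^esub> \<longleftrightarrow> comb H (f(v := ?b)) m (K + 2) = \<one>\<^bsub>H\<^esub>"
        unfolding upd H.comb_upd[OF f b vK]
        using generic[OF m0, of "m v"] gb[OF m0, of "m v"] eqs[OF coeffs_le_mono[OF m0 N'N]]
        by (cases "m v = 0") (simp_all add: Gs(1) Hs(1) del: fun_upd_apply)
    qed
  next
    case True
    then obtain r0 where r0: "P 0 r0" by blast
    obtain i r where i: "i \<le> 0 + r0" and r: "P i r" and least: "\<forall>u<r. \<not> P (Suc i) u"
      using stable_least_exponent[of P, OF r0] by blast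
    obtain s where s: "coeffs_le K (combination_bound N' i) s" and ar: "a [^]\<^bsub>G\<^esub> int r = ?c s"
      and r1: "1 \<le> int r" "int r \<le> N'" using r by (auto simp: P_def)
    have "i \<le> nat N'" using i r0 unfolding P_def by linarith
    then have iQ: "combination_bound N' i \<le> Q" unfolding Q_def by (rule combination_bound_mono[OF N'])
    \<comment> \<open>Divided by a power of the frame generator, the combination equal to
      \<open>a ^ r\<close> is an \<open>L' * r\<close>-th power. As \<open>L' * r\<close> divides
      \<open>L\<close>, the same holds in \<open>H\<close>, and a root there is the
      \<open>b'\<close> sought.\<close>
    have "?c s = a' [^]\<^bsub>G\<^esub> (L' * int r) \<otimes>\<^bsub>G\<^esub> e K [^]\<^bsub>G\<^esub> (j * int r)"
      unfolding ar[symmetric] a'(2) using a'(1) eK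
      by (simp add: G.int_pow_distrib G.int_pow_pow G.m_comm)
    then have "?c s \<otimes>\<^bsub>G\<^esub> inv\<^bsub>G\<^esub> (e K [^]\<^bsub>G\<^esub> (j * int r)) = a' [^]\<^bsub>G\<^esub> (L' * int r)"
      using G.inv_solve_right'[of "a' [^]\<^bsub>G\<^esub> (L' * int r)" "?c s" "e K [^]\<^bsub>G\<^esub> (j * int r)"]
        a'(1) eK Gs(1) by simp
    then have "?c (\<lambda>i. s i + - mg (j * int r) i) = a' [^]\<^bsub>G\<^esub> (L' * int r)"
      by (simp only: Gs mg)
    then have "?c (\<lambda>i. s i + - mg (j * int r) i) \<in> powers G (L' * int r)"
      using a' by (auto simp: powers_def)
    then have "?d (\<lambda>i. s i + - mg (j * int r) i) \<in> powers H (L' * int r)"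
      using divs[OF L[OF r1]] by blast
    then obtain b' where b': "b' \<in> carrier H"
      and "?d (\<lambda>i. s i + - mg (j * int r) i) = b' [^]\<^bsub>H\<^esub> (L' * int r)"
      by (auto simp: powers_def)
    then have ds: "?d s \<otimes>\<^bsub>H\<^esub> inv\<^bsub>H\<^esub> (f K [^]\<^bsub>H\<^esub> (j * int r)) = b' [^]\<^bsub>H\<^esub> (L' * int r)"
      by (simp only: Hs mg)
    define b where "b = f K [^]\<^bsub>H\<^esub> j \<otimes>\<^bsub>H\<^esub> b' [^]\<^bsub>H\<^esub> L'"
    have b: "b \<in> carrier H" using b' fK by (simp add: b_def)
    have br: "b [^]\<^bsub>H\<^esub> int r = ?d s"
      using H.inv_solve_right'[of "b' [^]\<^bsub>H\<^esub> (L' * int r)" "?d s" "f K [^]\<^bsub>H\<^esub> (j * int r)"]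
        ds b' fK Hs(1)
      by (simp add: b_def H.int_pow_distrib H.int_pow_pow H.m_comm)
    show ?thesis
    proof (rule finish[OF b'], fold b_def)
      fix m assume m: "coeffs_le K N' m"
      \<comment> \<open>Division by \<open>r\<close> trades the exponent of \<open>a\<close> for the
        combination \<open>q * s\<close> and a remainder below \<open>r\<close>, to which leastness
        applies.\<close>
      define q u where "q = m v div int r" and "u = m v mod int r"
      have mv: "m v = int r * q + u" by (simp add: q_def u_def)
      have u: "0 \<le> u" "u < int r" using r1 by (auto simp: u_def)
      have "\<bar>m v\<bar> \<le> N'" using m v by (simp add: coeffs_le_def)
      then have q: "\<bar>q\<bar> \<le> N'"
        unfolding q_def using r1 by (smt (verit) div_by_1 int_div_less_self neg_imp_zdiv_neg_iff pos_imp_zdiv_nonneg_iff zdiv_mono2 zdiv_mono2_neg)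
      define w where "w i = (m(v := 0)) i + q * s i" for i
      have w_le: "coeffs_le K (combination_bound N' (Suc i)) w"
        unfolding coeffs_le_def
      proof (intro allI impI)
        fix k assume "k \<le> K"
        then have "\<bar>(m(v := 0)) k\<bar> \<le> N'" "\<bar>s k\<bar> \<le> combination_bound N' i"
          using m s N' by (auto simp: coeffs_le_def)
        moreover have "\<bar>q * s k\<bar> \<le> N' * combination_bound N' i"
          unfolding abs_mult using q N' by (intro mult_mono) (use calculation in auto)
        ultimately show "\<bar>w k\<bar> \<le> combination_bound N' (Suc i)" unfolding w_def by simp
      qed
      have Suc_iQ: "combination_bound N' (Suc i) \<le> N' * Q + N'"
        using mult_left_mono[OF iQ, of N'] N' by simp
      have wQ: "coeffs_le K (N' * Q + N') w" using w_le Suc_iQ by (rule coeffs_le_mono)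
      have cw: "comb G (e(v := a)) m (K + 2) = ?c w \<otimes>\<^bsub>G\<^esub> a [^]\<^bsub>G\<^esub> u"
        unfolding upd w_def mv using a
        by (simp only: Gs G.int_pow_mult G.int_pow_closed G.m_assoc ar flip: G.int_pow_pow)
      have dw: "comb H (f(v := b)) m (K + 2) = ?d w \<otimes>\<^bsub>H\<^esub> b [^]\<^bsub>H\<^esub> u"
        unfolding H.comb_upd[OF f b vK] w_def mv using b
        by (simp only: Hs H.int_pow_mult H.int_pow_closed H.m_assoc br flip: H.int_pow_pow)
      have no_small: "?c w' \<noteq> a [^]\<^bsub>G\<^esub> u" if "0 < u" "coeffs_le K (combination_bound N' (Suc i)) w'" for w'
      proof
        assume "?c w' = a [^]\<^bsub>G\<^esub> u"
        then have "P (Suc i) (nat u)" using that u r1 unfolding P_def by (auto simp del: combination_bound.simps)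
        moreover have "nat u < r" using u by simp
        ultimately show False using least by blast
      qed
      show "comb G (e(v := a)) m (K + 2) = \<one>\<^bsub>G\<^esub> \<longleftrightarrow> comb H (f(v := b)) m (K + 2) = \<one>\<^bsub>H\<^esub>"
      proof (cases "u = 0")
        case True
        then show ?thesis using eqs[OF coeffs_le_mono[OF wQ N'Q]] unfolding cw dw
          by (simp only: Gs(1) Hs(1) int_pow_0 G.r_one H.r_one)
      next
        case False
        then have u0: "0 < u" using u by simp
        have "?c w \<otimes>\<^bsub>G\<^esub> a [^]\<^bsub>G\<^esub> u \<noteq> \<one>\<^bsub>G\<^esub>"
        proof
          assume "?c w \<otimes>\<^bsub>G\<^esub> a [^]\<^bsub>G\<^esub> u = \<one>\<^bsub>G\<^esub>"
          then have "?c (\<lambda>i. - w i) = a [^]\<^bsub>G\<^esub> u"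
            using a by (simp only: Gs) (metis G.comb_closed[OF e] G.int_pow_closed G.inv_equality G.m_comm)
          moreover have "coeffs_le K (combination_bound N' (Suc i)) (\<lambda>i. - w i)"
            using w_le by (simp add: coeffs_le_def)
          ultimately show False using no_small[OF u0] by blast
        qed
        moreover have "?d w \<otimes>\<^bsub>H\<^esub> b [^]\<^bsub>H\<^esub> u \<noteq> \<one>\<^bsub>H\<^esub>"
        proof
          assume "?d w \<otimes>\<^bsub>H\<^esub> b [^]\<^bsub>H\<^esub> u = \<one>\<^bsub>H\<^esub>"
          then have "(?d w \<otimes>\<^bsub>H\<^esub> b [^]\<^bsub>H\<^esub> u) [^]\<^bsub>H\<^esub> int r = \<one>\<^bsub>H\<^esub>" by simp
          moreover have "(b [^]\<^bsub>H\<^esub> u) [^]\<^bsub>H\<^esub> int r = (b [^]\<^bsub>H\<^esub> int r) [^]\<^bsub>H\<^esub> u"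
            using b by (simp only: H.int_pow_pow mult.commute)
          ultimately have "?d (\<lambda>i. int r * w i + u * s i) = \<one>\<^bsub>H\<^esub>"
            using b by (simp only: Hs H.int_pow_distrib H.int_pow_closed br)
          moreover have "coeffs_le K N (\<lambda>i. int r * w i + u * s i)"
            unfolding coeffs_le_def
          proof (intro allI impI)
            fix k assume k: "k \<le> K"
            have "\<bar>int r * w k\<bar> \<le> N' * (N' * Q + N')"
              unfolding abs_mult using r1 wQ k N' by (intro mult_mono) (auto simp: coeffs_le_def)
            moreover have "\<bar>u * s k\<bar> \<le> N' * Q"
              unfolding abs_mult using u r1 coeffs_le_mono[OF s iQ] k N' by (intro mult_mono) (auto simp: coeffs_le_def)
            ultimately show "\<bar>int r * w k + u * s k\<bar> \<le> N" using N_eq N' by linarith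
          qed
          ultimately have "?c (\<lambda>i. int r * w i + u * s i) = \<one>\<^bsub>G\<^esub>" using eqs by blast
          then have "?c w [^]\<^bsub>G\<^esub> int r \<otimes>\<^bsub>G\<^esub> (a [^]\<^bsub>G\<^esub> int r) [^]\<^bsub>G\<^esub> u = \<one>\<^bsub>G\<^esub>" by (simp only: Gs ar)
          moreover have "(a [^]\<^bsub>G\<^esub> u) [^]\<^bsub>G\<^esub> int r = (a [^]\<^bsub>G\<^esub> int r) [^]\<^bsub>G\<^esub> u"
            using a by (simp only: G.int_pow_pow mult.commute)
          ultimately have tors: "(?c w \<otimes>\<^bsub>G\<^esub> a [^]\<^bsub>G\<^esub> u) [^]\<^bsub>G\<^esub> int r = \<one>\<^bsub>G\<^esub>"
            using a by (simp only: Gs G.int_pow_distrib G.int_pow_closed)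
          have "int r dvd \<Lambda>" using L[OF r1] L\<Lambda> by (meson dvd_mult_right dvd_trans)
          then obtain k where k: "\<Lambda> = int r * k" by blast
          have "(?c w \<otimes>\<^bsub>G\<^esub> a [^]\<^bsub>G\<^esub> u) [^]\<^bsub>G\<^esub> \<Lambda> = \<one>\<^bsub>G\<^esub>"
            unfolding k using tors a Gs(1) by (simp flip: G.int_pow_pow)
          moreover have "?c w \<otimes>\<^bsub>G\<^esub> a [^]\<^bsub>G\<^esub> u \<in> carrier G" using a Gs(1) by simp
          ultimately obtain k' :: int where "?c w \<otimes>\<^bsub>G\<^esub> a [^]\<^bsub>G\<^esub> u = e (K + 1) [^]\<^bsub>G\<^esub> k'"
            using frG unfolding framed_def by blast
          moreover have "e (K + 1) [^]\<^bsub>G\<^esub> k' = ?c (\<lambda>i. if i = K + 1 then k' else 0)"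
            by (rule G.comb_single[OF e, symmetric]) simp
          ultimately have "?c (\<lambda>i. - w i + (if i = K + 1 then k' else 0)) = a [^]\<^bsub>G\<^esub> u"
            using a unfolding Gs(2,4) by (metis G.comb_closed[OF e] G.int_pow_closed G.inv_solve_left' G.m_closed)
          moreover have "coeffs_le K (combination_bound N' (Suc i)) (\<lambda>i. - w i + (if i = K + 1 then k' else 0))"
            using w_le by (simp add: coeffs_le_def)
          ultimately show False using no_small[OF u0] by blast
        qed
        ultimately show ?thesis unfolding cw dw by blast
      qed
    qed
  qed
qed

section \<open>Torsion and cotorsion of kernels\<close>

lemma (in field) roots_of_unity:
  assumes "d > 0"
  shows "finite {x \<in> carrier R. x [^] d = \<one>}" "card {x \<in> carrier R. x [^] d = \<one>} \<le> d"
proof -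
  \<comment> \<open>The polynomial \<open>X ^ d - 1\<close>, leading coefficient first.\<close>
  define p where "p = \<one> # (replicate (d - 1) \<zero> @ [\<ominus> \<one>])"
  have p: "p \<in> carrier (poly_ring R)" "p \<noteq> []" "degree p = d"
    using assms unfolding p_def sym[OF univ_poly_carrier] polynomial_def by (auto simp: set_replicate_conv_if)
  have "eval p x = x [^] d \<ominus> \<one>" if "x \<in> carrier R" for x
    using that eval_replicate[of "[\<ominus> \<one>]" x "d - 1"] assms by (simp add: p_def minus_eq)
  then have sub: "{x \<in> carrier R. x [^] d = \<one>} \<subseteq> set_mset (roots p)"
    using p(2) by (auto simp: roots_mem_iff_is_root[OF p(1)] is_root_def)
  then show "finite {x \<in> carrier R. x [^] d = \<one>}" by (rule finite_subset) simp
  have "card {x \<in> carrier R. x [^] d = \<one>} \<le> card (set_mset (roots p))"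
    using sub by (intro card_mono) simp
  also have "\<dots> \<le> size (roots p)" 
    unfolding size_multiset_overloaded_eq card_eq_sum by (rule sum_mono) (simp add: Suc_le_eq)
  also have "\<dots> \<le> d" using size_roots_le_degree[OF p(1)] p(3) by simp
  finally show "card {x \<in> carrier R. x [^] d = \<one>} \<le> d" .
qed

text \<open>
  Take \<open>z\<close> of maximal order. If some torsion element lay outside \<open>\<langle>z\<rangle>\<close>, a power of it would have a
  prime power \<open>x\<^sup>p \<in> \<langle>z\<rangle>\<close>, which yields either an element of larger order or more than \<open>p\<close>
  elements of order dividing \<open>p\<close>.
\<close>

lemma (in comm_group) torsion_cyclic:
  assumes bound: "\<And>d::nat. d > 0 \<Longrightarrow> finite {x \<in> carrier G. x [^] d = \<one>} \<and> card {x \<in> carrier G. x [^] d = \<one>} \<le> d"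
    and n: "(n::nat) > 0"
  shows "\<exists>z\<in>carrier G. z [^] n = \<one> \<and> (\<forall>x\<in>carrier G. x [^] n = \<one> \<longrightarrow> (\<exists>i::int. x = z [^] i))"
proof -
  let ?T = "{x \<in> carrier G. x [^] n = \<one>}"
  have fin: "finite ?T" using bound[OF n] by blast
  have T_ne: "\<one> \<in> ?T" by simp
  define \<mu> where "\<mu> = Max (ord ` ?T)"
  have "\<mu> \<in> ord ` ?T" unfolding \<mu>_def using fin T_ne by (intro Max_in) blast+
  then obtain z where z: "z \<in> carrier G" "z [^] n = \<one>" "ord z = \<mu>" by auto
  have max: "ord x \<le> \<mu>" if "x \<in> ?T" for x unfolding \<mu>_def using fin that by (intro Max_ge) auto
  have \<mu>: "\<mu> > 0" using z n pow_eq_id[of z n] by (cases "\<mu> = 0") auto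
  have z_eq: "z [^] i = \<one> \<longleftrightarrow> int \<mu> dvd i" for i :: int using int_pow_eq_id[OF z(1)] z(3) by simp
  have T_int: "x \<in> ?T \<longleftrightarrow> x \<in> carrier G \<and> x [^] int n = \<one>" for x by (simp add: int_pow_int)
  have T_mult: "x \<otimes> y \<in> ?T" if "x \<in> ?T" "y \<in> ?T" for x y
    using that by (simp add: nat_pow_distrib)
  have T_pow: "x [^] (i::int) \<in> ?T" if "x \<in> ?T" for x i
  proof -
    have "(x [^] i) [^] int n = (x [^] int n) [^] i" using that by (simp add: int_pow_pow mult.commute)
    then show ?thesis using that by (simp add: int_pow_int)
  qed
  have zT: "z \<in> ?T" using z by simp
  have "\<exists>i::int. x = z [^] i" if x: "x \<in> ?T" for x
  proof (rule ccontr)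
    assume notin: "\<not> ?thesis"
    \<comment> \<open>For a prime \<open>p\<close> dividing \<open>k\<close>, leastness keeps
      \<open>x ^ (k div p)\<close> outside the powers of \<open>z\<close> while its
      \<open>p\<close>-th power lies inside: this is \<open>y\<close> below.\<close>
    define k where "k = (LEAST k. 0 < k \<and> (\<exists>i::int. x [^] int k = z [^] i))"
    have "0 < n \<and> (\<exists>i::int. x [^] int n = z [^] i)"
      using x n by (auto simp: int_pow_int intro: exI[of _ 0])
    then have k: "0 < k" "\<exists>i::int. x [^] int k = z [^] i"
      using LeastI[of "\<lambda>k. 0 < k \<and> (\<exists>i::int. x [^] int k = z [^] i)"] unfolding k_def by blast+
    have k_least: "\<not> (\<exists>i::int. x [^] int l = z [^] i)" if "0 < l" "l < k" for l
      using not_less_Least[of l "\<lambda>k. 0 < k \<and> (\<exists>i::int. x [^] int k = z [^] i)"] that unfolding k_def by blast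
    have "k \<noteq> 1" using k(2) notin x by auto
    then obtain p where p: "Factorial_Ring.prime p" "p dvd k" using prime_factor_nat by blast
    then obtain l where l: "k = l * p" by (auto simp: dvd_def mult.commute)
    define y where "y = x [^] int l"
    have y: "y \<in> ?T" unfolding y_def using x by (rule T_pow)
    have "0 < l" "l < k" using l k(1) prime_gt_1_nat[OF p(1)] by auto
    then have y_notin: "y \<noteq> z [^] i" for i :: int using k_least unfolding y_def by blast
    obtain j0 :: int where j0: "y [^] int p = z [^] j0"
      using k(2) x unfolding y_def l by (auto simp: int_pow_pow)
    have ip: "Factorial_Ring.prime (int p)" using p(1) by simp
    \<comment> \<open>If \<open>p\<close> does not divide \<mu>, it is invertible modulo \<mu>, so
      the exponent can be replaced by a multiple of \<open>p\<close>.\<close>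
    obtain j where j: "y [^] int p = z [^] j" and jp: "int p dvd j \<or> p dvd \<mu>"
    proof (cases "p dvd \<mu>")
      case False
      then have "coprime (int \<mu>) (int p)"
        using prime_imp_coprime[OF p(1)] by (metis coprime_commute coprime_int_iff)
      then obtain a b where ab: "a * int \<mu> + b * int p = 1"
        by (metis bezout_int coprime_imp_gcd_eq_1)
      have "j0 = j0 * (a * int \<mu> + b * int p)" using ab by simp
      then have "j0 = int \<mu> * (j0 * a) + j0 * b * int p" by (simp add: algebra_simps)
      then have "z [^] j0 = z [^] (int \<mu> * (j0 * a)) \<otimes> z [^] (j0 * b * int p)"
        using z(1) by (metis int_pow_mult)
      moreover have "z [^] (int \<mu> * (j0 * a)) = \<one>" by (simp add: z_eq)
      ultimately show thesis using that[of "j0 * b * int p"] j0 z(1) by simp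
    qed (use that j0 in blast)
    show False
    proof (cases "int p dvd j")
      case True
      then obtain i where i: "j = int p * i" by blast
      \<comment> \<open>\<open>w\<close> has \<open>p\<close>-th power 1 and stays outside the
        powers of \<open>z\<close>. If \<open>p\<close> divides \<mu>, it joins the \<open>p\<close>
        powers of \<open>z ^ (\<mu> div p)\<close> as one solution too many; otherwise
        \<open>w\<close> times \<open>z\<close> has order at least \<open>p * \<mu>\<close>.\<close>
      define w where "w = y \<otimes> z [^] (- i)"
      have w: "w \<in> ?T" unfolding w_def using T_mult[OF y T_pow[OF zT]] by blast
      have wp: "w [^] int p = \<one>"
        using y z(1) j i by (simp add: w_def int_pow_distrib int_pow_pow mult.commute flip: int_pow_mult)
      have w_notin: "w \<noteq> z [^] s" for s :: int
      proof
        assume "w = z [^] s"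
        then have "y = z [^] s \<otimes> z [^] i"
          using y z(1) unfolding w_def by (simp add: int_pow_neg) (metis inv_solve_right int_pow_closed inv_solve_right')
        then show False using y_notin[of "s + i"] z(1) by (simp add: int_pow_mult)
      qed
      show False
      proof (cases "p dvd \<mu>")
        case True
        then obtain q where q: "\<mu> = p * q" by blast
        let ?P = "{x \<in> carrier G. x [^] p = \<one>}" and ?f = "\<lambda>s::nat. z [^] (int q * int s)"
        have "inj_on ?f {..<p}"
        proof (rule inj_onI)
          fix s s' assume s: "s \<in> {..<p}" "s' \<in> {..<p}" "?f s = ?f s'"
          have "int \<mu> dvd int q * int s' - int q * int s" using s(3) int_pow_eq[OF z(1)] z(3) by simp
          then have "int p dvd int s' - int s"
            using q \<mu> by (simp add: right_diff_distrib[symmetric] mult.commute[of "int p"])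
          then show "s = s'" using s(1,2) dvd_imp_le_int[of "int s' - int s" "int p"] by fastforce
        qed
        then have card: "card (insert w (?f ` {..<p})) = Suc p"
          using w_notin by (subst card_insert_disjoint) (auto simp: card_image)
        have "(?f s) [^] p = \<one>" for s
          using z(1) z_eq by (simp add: q int_pow_pow flip: int_pow_int)
        then have "insert w (?f ` {..<p}) \<subseteq> ?P"
          using w wp z(1) by (auto simp: int_pow_int)
        then have "Suc p \<le> card ?P" using card bound[of p] prime_gt_0_nat[OF p(1)] by (metis card_mono)
        then show False using bound[of p] prime_gt_0_nat[OF p(1)] by auto
      next
        case False
        then have cop: "coprime (int p) (int \<mu>)" using prime_imp_coprime[OF p(1)] by simp
        define m where "m = ord (w \<otimes> z)"
        have wz: "w \<otimes> z \<in> ?T" using T_mult[OF w zT] .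
        have "(w \<otimes> z) [^] int m = \<one>" using wz by (simp add: m_def int_pow_int)
        then have eq: "w [^] int m \<otimes> z [^] int m = \<one>" using w z(1) by (simp add: int_pow_distrib)
        then have "(w [^] int m \<otimes> z [^] int m) [^] int \<mu> = \<one>" by simp
        then have wm: "w [^] (int m * int \<mu>) = \<one>"
          using w z(1) z_eq[of "int m * int \<mu>"] by (simp add: int_pow_distrib int_pow_pow)
        have "w \<noteq> \<one>" using w_notin[of 0] by simp
        then have "ord w = p"
          using wp w p(1) int_pow_eq_id[of w "int p"] ord_eq_1[of w] by (auto simp: prime_nat_iff)
        then have w_eq: "w [^] i = \<one> \<longleftrightarrow> int p dvd i" for i :: int using int_pow_eq_id[of w] w by simp
        have pm: "int p dvd int m" using wm cop by (simp add: w_eq coprime_dvd_mult_left_iff)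
        then have "z [^] int m = \<one>" using eq w_eq[of "int m"] z(1) by simp
        then have "int \<mu> dvd int m" by (simp add: z_eq)
        then have "int p * int \<mu> dvd int m" using pm cop by (simp add: divides_mult)
        moreover have "m > 0" using wz n pow_eq_id[of "w \<otimes> z" n] by (cases "m = 0") (auto simp: m_def)
        ultimately have "int p * int \<mu> \<le> int m" by (intro zdvd_imp_le) auto
        moreover have "int \<mu> < int p * int \<mu>" using prime_gt_1_nat[OF p(1)] \<mu> by simp
        ultimately show False using max[OF wz] by (simp add: m_def)
      qed
    next
      case False
      then have "coprime j (int p)" using prime_imp_coprime[OF ip] coprime_commute by blast
      then obtain a b where ab: "a * j + b * int p = 1"
        by (metis bezout_int coprime_imp_gcd_eq_1)
      \<comment> \<open>A \<open>p\<close>-th root of \<open>z\<close>. Its order is a multiple of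
        \<mu>, hence \<mu> by maximality; so \<open>z ^ (\<mu> div p)\<close> equals
        \<open>t ^ \<mu>\<close>, which is 1, against the order of \<open>z\<close>.\<close>
      define t where "t = y [^] a \<otimes> z [^] b"
      have t: "t \<in> ?T" unfolding t_def using T_mult[OF T_pow[OF y] T_pow[OF zT]] .
      have "t [^] int p = (y [^] int p) [^] a \<otimes> z [^] (b * int p)"
        using y z(1) unfolding t_def by (simp add: int_pow_distrib int_pow_pow mult.commute)
      also have "\<dots> = z" using z(1) ab by (simp add: j int_pow_pow mult.commute flip: int_pow_mult)
      finally have tp: "t [^] int p = z" .
      define m where "m = ord t"
      have m0: "m > 0" using t n pow_eq_id[of t n] by (cases "m = 0") (auto simp: m_def)
      have t_eq: "t [^] i = \<one> \<longleftrightarrow> int m dvd i" for i :: int using int_pow_eq_id[of t] t by (simp add: m_def)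
      have "z [^] int m = (t [^] int m) [^] int p" using t by (simp add: tp[symmetric] int_pow_pow mult.commute)
      then have "int \<mu> dvd int m" using t_eq[of "int m"] z_eq[of "int m"] by simp
      then have "\<mu> \<le> m" using m0 by (simp add: dvd_imp_le)
      then have m_eq: "m = \<mu>" using max[OF t] by (simp add: m_def)
      obtain q where q: "\<mu> = p * q" using False jp by blast
      have "z [^] int q = t [^] int \<mu>" using t by (simp add: tp[symmetric] int_pow_pow q)
      also have "\<dots> = \<one>" using t_eq m_eq by simp
      finally have "\<mu> dvd q" by (simp add: z_eq)
      moreover have "q > 0" using q \<mu> by (cases q) auto
      ultimately have "\<mu> \<le> q" by (simp add: dvd_imp_le)
      moreover have "q < \<mu>" using q \<open>q > 0\<close> prime_gt_1_nat[OF p(1)] by simp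
      ultimately show False by simp
    qed
  qed
  then show ?thesis using z by blast
qed

section \<open>Frames and the kernel of a surjective endomorphism\<close>

text \<open>In a finite cyclic group the \<open>n\<close>-torsion and the quotient by
  \<open>n\<close>-th powers both have as order the gcd of \<open>n\<close> and the group order.
  Using one \<open>q\<close> for both records this equality.\<close>

definition cyclic_frame :: "('a, 'b) monoid_scheme \<Rightarrow> int \<Rightarrow> int \<Rightarrow> 'a \<Rightarrow> 'a \<Rightarrow> bool" where
  "cyclic_frame G n q g t \<longleftrightarrow> comm_group G \<and> 0 < n \<and> 0 < q \<and> q dvd n \<and> g \<in> carrier G \<and> t \<in> carrier G \<and>
     (\<forall>x\<in>carrier G. \<exists>j::int. \<exists>y\<in>carrier G. x = g [^]\<^bsub>G\<^esub> j \<otimes>\<^bsub>G\<^esub> y [^]\<^bsub>G\<^esub> n) \<and>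
     (\<forall>j::int. g [^]\<^bsub>G\<^esub> j \<in> powers G n \<longleftrightarrow> q dvd j) \<and>
     (\<forall>i::int. t [^]\<^bsub>G\<^esub> i = \<one>\<^bsub>G\<^esub> \<longleftrightarrow> q dvd i) \<and>
     (\<forall>x\<in>carrier G. x [^]\<^bsub>G\<^esub> n = \<one>\<^bsub>G\<^esub> \<longrightarrow> (\<exists>i::int. x = t [^]\<^bsub>G\<^esub> i))"

text \<open>
  With \<open>z\<close> generating the \<open>n\<close>-torsion of \<open>G\<close>, choose \<open>y\<close> with \<open>h y = z\<close>; then \<open>g = y\<^sup>n\<close> generates
  \<open>ker h\<close> modulo \<open>n\<close>-th powers (the connecting map of the snake lemma), and both the \<open>n\<close>-torsion and
  the \<open>n\<close>-cotorsion of \<open>ker h\<close> have order \<open>gcd k (ord z)\<close>, where \<open>h z = z\<^sup>k\<close>.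
\<close>

lemma kernel_cyclic_frame:
  assumes G: "comm_group G" and div: "divisible_group G" and h: "h \<in> epi G G" and n: "n > 0"
    and z: "z \<in> carrier G" "z [^]\<^bsub>G\<^esub> n = \<one>\<^bsub>G\<^esub>"
    and z_gen: "\<And>x. x \<in> carrier G \<Longrightarrow> x [^]\<^bsub>G\<^esub> n = \<one>\<^bsub>G\<^esub> \<Longrightarrow> \<exists>i::int. x = z [^]\<^bsub>G\<^esub> i"
  shows "\<exists>q g t. cyclic_frame (G\<lparr>carrier := kernel G G h\<rparr>) (n::int) q g t"
proof -
  interpret G: comm_group G by fact
  interpret h: group_hom G G h using h by (unfold_locales) (simp add: epi_def)
  let ?K = "kernel G G h" and ?A = "G\<lparr>carrier := kernel G G h\<rparr>"
  have sub: "subgroup ?K G" by (rule h.subgroup_kernel)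
  have K: "x \<in> ?K \<longleftrightarrow> x \<in> carrier G \<and> h x = \<one>\<^bsub>G\<^esub>" for x by (auto simp: kernel_def)
  interpret A: comm_group ?A
    using subgroup.subgroup_is_group[OF sub G.is_group] G.m_comm K
    by (intro group.group_comm_groupI) auto
  have pow: "x [^]\<^bsub>?A\<^esub> (i::int) = x [^]\<^bsub>G\<^esub> i" if "x \<in> ?K" for x i
    using G.int_pow_consistent[OF sub that] by simp
  define \<mu> where "\<mu> = int (G.ord z)"
  have z_eq: "z [^]\<^bsub>G\<^esub> i = \<one>\<^bsub>G\<^esub> \<longleftrightarrow> \<mu> dvd i" for i :: int
    unfolding \<mu>_def by (rule G.int_pow_eq_id[OF z(1)])
  have \<mu>n: "\<mu> dvd n" using z z_eq by blast
  then have \<mu>0: "\<mu> > 0" using n by (metis \<mu>_def dvd_0_left_iff less_irrefl of_nat_0_le_iff order_le_less)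
  have hz: "h z \<in> carrier G" using z by simp
  have "h z [^]\<^bsub>G\<^esub> n = h (z [^]\<^bsub>G\<^esub> n)" using h.hom_int_pow[OF z(1)] by simp
  then have "h z [^]\<^bsub>G\<^esub> n = \<one>\<^bsub>G\<^esub>" using z by simp
  then obtain k :: int where k: "h z = z [^]\<^bsub>G\<^esub> k" using z_gen[OF hz] by blast
  have hzi: "h (z [^]\<^bsub>G\<^esub> i) = z [^]\<^bsub>G\<^esub> (k * i)" for i :: int
    using h.hom_int_pow[OF z(1), of i] k z(1) by (simp add: G.int_pow_pow)
  define q where "q = gcd k \<mu>"
  have q: "q > 0" "q dvd \<mu>" "q dvd k" using \<mu>0 by (auto simp: q_def)
  obtain \<nu> where \<nu>: "\<mu> = q * \<nu>" using q(2) by blast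
  have \<nu>0: "\<nu> > 0" using \<mu>0 q(1) \<nu> by (metis zero_less_mult_pos)
  obtain \<kappa> where \<kappa>: "k = q * \<kappa>" using q(3) by blast
  have "gcd (q * \<kappa>) (q * \<nu>) = q" unfolding \<nu>[symmetric] \<kappa>[symmetric] by (rule q_def[symmetric])
  then have cop: "coprime \<kappa> \<nu>" using q(1) by (simp add: gcd_mult_left coprime_iff_gcd_eq_1)
  have mu_k: "\<mu> dvd k * i \<longleftrightarrow> \<nu> dvd i" for i
    using \<nu> \<kappa> q(1) cop by (simp add: mult.assoc coprime_commute coprime_dvd_mult_right_iff)
  define t where "t = z [^]\<^bsub>G\<^esub> \<nu>"
  have tK: "t \<in> ?K" using z(1) by (simp add: K t_def hzi z_eq mu_k)
  obtain y where y: "y \<in> carrier G" "h y = z" using h z(1) by (force simp: epi_def)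
  define g where "g = y [^]\<^bsub>G\<^esub> n"
  have hpow: "h (x [^]\<^bsub>G\<^esub> i) = h x [^]\<^bsub>G\<^esub> i" if "x \<in> carrier G" for x and i :: int
    using h.hom_int_pow[OF that] .
  have gK: "g \<in> ?K" using y z by (simp add: K g_def hpow)
  have root: "\<exists>w\<in>carrier G. w [^]\<^bsub>G\<^esub> n = x" if "x \<in> carrier G" for x
  proof -
    have "nat n > 0" using n by simp
    then obtain w where "w \<in> carrier G" "w [^]\<^bsub>G\<^esub> nat n = x" using div \<open>x \<in> carrier G\<close> unfolding divisible_group_def by blast
    then show ?thesis using n by (auto simp flip: int_pow_int intro!: bexI[of _ w])
  qed
  have "cyclic_frame ?A n q g t"
    unfolding cyclic_frame_def
  proof (intro conjI ballI allI impI)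
    show "q dvd n" using q(2) \<mu>n by (rule dvd_trans)
  next
    fix x assume "x \<in> carrier ?A"
    then have x: "x \<in> ?K" "x \<in> carrier G" by (auto simp: K)
    \<comment> \<open>The root taken in \<open>G\<close> misses the kernel by the
      \<open>n\<close>-torsion value \<open>h w\<close>, a power of \<open>z\<close>; the same power
      of \<open>y\<close> corrects it.\<close>
    obtain w where w: "w \<in> carrier G" "w [^]\<^bsub>G\<^esub> n = x" using root x(2) by blast
    have "h w [^]\<^bsub>G\<^esub> n = \<one>\<^bsub>G\<^esub>" using w x(1) hpow[OF w(1), of n] by (simp add: K)
    then obtain j :: int where j: "h w = z [^]\<^bsub>G\<^esub> j" using z_gen[OF h.hom_closed[OF w(1)]] by blast
    define v where "v = w \<otimes>\<^bsub>G\<^esub> inv\<^bsub>G\<^esub> (y [^]\<^bsub>G\<^esub> j)"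
    have v: "v \<in> carrier G" "h v = \<one>\<^bsub>G\<^esub>" using w(1) y z(1) j by (auto simp: v_def hpow)
    then have vK: "v \<in> ?K" by (simp add: K)
    have "w = y [^]\<^bsub>G\<^esub> j \<otimes>\<^bsub>G\<^esub> v" using w(1) y(1) by (simp add: v_def G.m_lcomm)
    then have "x = (y [^]\<^bsub>G\<^esub> j) [^]\<^bsub>G\<^esub> n \<otimes>\<^bsub>G\<^esub> v [^]\<^bsub>G\<^esub> n"
      using w(2) y(1) v(1) by (simp add: G.int_pow_distrib)
    then have "x = g [^]\<^bsub>G\<^esub> j \<otimes>\<^bsub>G\<^esub> v [^]\<^bsub>G\<^esub> n"
      using y(1) by (simp add: g_def G.int_pow_pow mult.commute)
    then show "\<exists>j::int. \<exists>y\<in>carrier ?A. x = g [^]\<^bsub>?A\<^esub> j \<otimes>\<^bsub>?A\<^esub> y [^]\<^bsub>?A\<^esub> n"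
      using vK gK by (intro exI[of _ j] bexI[of _ v]) (simp_all add: pow)
    assume "x [^]\<^bsub>?A\<^esub> n = \<one>\<^bsub>?A\<^esub>"
    then have "x [^]\<^bsub>G\<^esub> n = \<one>\<^bsub>G\<^esub>" using x pow by simp
    then obtain i :: int where i: "x = z [^]\<^bsub>G\<^esub> i" using z_gen x by blast
    have "\<nu> dvd i" using x(1) i by (simp add: K hzi z_eq mu_k)
    then obtain s where "i = \<nu> * s" by blast
    then have "x = t [^]\<^bsub>G\<^esub> s" using i z(1) by (simp add: t_def G.int_pow_pow)
    then show "\<exists>i::int. x = t [^]\<^bsub>?A\<^esub> i" using pow[OF tK] by auto
  next
    fix j :: int
    show "g [^]\<^bsub>?A\<^esub> j \<in> powers ?A n \<longleftrightarrow> q dvd j"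
    proof
      assume "g [^]\<^bsub>?A\<^esub> j \<in> powers ?A n"
      then obtain w where w: "w \<in> ?K" "g [^]\<^bsub>G\<^esub> j = w [^]\<^bsub>G\<^esub> n" using gK by (auto simp: powers_def pow)
      then have wG: "w \<in> carrier G" "h w = \<one>\<^bsub>G\<^esub>" by (auto simp: K)
      \<comment> \<open>\<open>y ^ j\<close> and \<open>w\<close> have the same \<open>n\<close>-th
        power, so they differ by some \<open>z ^ i\<close>; applying \<open>h\<close> compares
        \<open>j\<close> with \<open>k * i\<close> modulo \<mu>.\<close>
      have "(y [^]\<^bsub>G\<^esub> j \<otimes>\<^bsub>G\<^esub> inv\<^bsub>G\<^esub> w) [^]\<^bsub>G\<^esub> n = \<one>\<^bsub>G\<^esub>"
        using w(2) wG y(1) by (simp add: G.int_pow_distrib G.int_pow_inv g_def G.int_pow_pow mult.commute)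
      moreover have "y [^]\<^bsub>G\<^esub> j \<otimes>\<^bsub>G\<^esub> inv\<^bsub>G\<^esub> w \<in> carrier G" using wG y(1) by simp
      ultimately obtain i :: int where i: "y [^]\<^bsub>G\<^esub> j \<otimes>\<^bsub>G\<^esub> inv\<^bsub>G\<^esub> w = z [^]\<^bsub>G\<^esub> i"
        using z_gen by blast
      have "h (y [^]\<^bsub>G\<^esub> j \<otimes>\<^bsub>G\<^esub> inv\<^bsub>G\<^esub> w) = z [^]\<^bsub>G\<^esub> j" using wG y z(1) by (simp add: hpow)
      then have "z [^]\<^bsub>G\<^esub> j = z [^]\<^bsub>G\<^esub> (k * i)" using i hzi by simp
      then have "\<mu> dvd k * i - j" using G.int_pow_eq[OF z(1)] by (simp add: \<mu>_def)
      then have "q dvd k * i - j" using q(2) dvd_trans by blast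
      moreover have "q dvd k * i" using q(3) by simp
      ultimately show "q dvd j" by (metis diff_add_cancel dvd_add_right_iff dvd_diff_commute)
    next
      assume "q dvd j"
      then obtain s where s: "j = q * s" by blast
      obtain a b where "a * k + b * \<mu> = q" unfolding q_def by (metis bezout_int)
      then have "j = (a * k + b * \<mu>) * s" using s by simp
      then have j: "j = k * (a * s) + \<mu> * (b * s)" by (simp add: algebra_simps)
      \<comment> \<open>By the Bezout identity \<open>h\<close> sends \<open>z ^ (a * s)\<close> to
        \<open>z ^ j\<close>, the value of \<open>h\<close> at \<open>y ^ j\<close>. The quotient
        thus lies in the kernel, and its \<open>n\<close>-th power is \<open>g ^ j\<close> because
        \<open>z ^ n\<close> is 1.\<close>
      define w where "w = y [^]\<^bsub>G\<^esub> j \<otimes>\<^bsub>G\<^esub> inv\<^bsub>G\<^esub> (z [^]\<^bsub>G\<^esub> (a * s))"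
      have zj: "z [^]\<^bsub>G\<^esub> j = z [^]\<^bsub>G\<^esub> (k * (a * s))"
        using G.int_pow_eq[OF z(1), of j "k * (a * s)"] j by (simp add: \<mu>_def)
      have wG: "w \<in> carrier G" using y(1) z(1) by (simp add: w_def)
      have wK: "w \<in> ?K" using y z(1) wG zj by (simp add: K) (simp add: w_def hpow hzi)
      have "w [^]\<^bsub>G\<^esub> n = g [^]\<^bsub>G\<^esub> j \<otimes>\<^bsub>G\<^esub> inv\<^bsub>G\<^esub> ((z [^]\<^bsub>G\<^esub> n) [^]\<^bsub>G\<^esub> (a * s))"
        using y(1) z(1) by (simp add: w_def g_def G.int_pow_distrib G.int_pow_inv G.int_pow_pow mult.commute)
      also have "\<dots> = g [^]\<^bsub>G\<^esub> j" using z(2) y(1) by (simp add: g_def)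
      finally show "g [^]\<^bsub>?A\<^esub> j \<in> powers ?A n"
        unfolding powers_def using wK gK by (intro image_eqI[of _ _ w]) (simp_all add: pow)
    qed
    have "t [^]\<^bsub>G\<^esub> j = z [^]\<^bsub>G\<^esub> (\<nu> * j)" using z(1) by (simp add: t_def G.int_pow_pow)
    then show "t [^]\<^bsub>?A\<^esub> j = \<one>\<^bsub>?A\<^esub> \<longleftrightarrow> q dvd j"
      using pow[OF tK] z_eq \<nu> \<nu>0 by (simp add: mult.commute)
  qed (use A.comm_group_axioms n q(1) gK tK in auto)
  then show ?thesis by blast
qed

section \<open>Finite cyclic companions\<close>

text \<open>\<open>P\<close> collects the primes of \<open>M\<close> not dividing \<open>c\<close>;
  modulo these \<open>h\<close> is \<open>c\<close>. Any other prime of \<open>M\<close> divides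
  \<open>c\<close> but neither \<open>q\<close> nor \<open>P\<close> nor the last factor, which is 1
  modulo \<open>M\<close> and serves to exceed \<open>B\<close>.\<close>

lemma coprime_lift:
  fixes q c M B :: int
  assumes "q > 0" "M > 0" and cop: "\<And>p. Factorial_Ring.prime p \<Longrightarrow> p dvd M \<Longrightarrow> p dvd q \<Longrightarrow> \<not> p dvd c"
  shows "\<exists>h>B. q dvd h - c \<and> coprime M h"
proof -
  define P where "P = \<Prod>{p \<in> prime_factors M. \<not> p dvd c}"
  define h where "h = c + q * P * (1 + M * (\<bar>B\<bar> + \<bar>c\<bar>))"
  have P: "P \<ge> 1" unfolding P_def
    by (rule prod_ge_1) (auto simp: in_prime_factors_iff dest!: prime_gt_0_int)
  have "1 * 1 \<le> q * P" using assms(1) P by (intro mult_mono) auto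
  have "1 + 1 * (\<bar>B\<bar> + \<bar>c\<bar>) \<le> 1 + M * (\<bar>B\<bar> + \<bar>c\<bar>)"
    using assms(2) by (intro add_left_mono mult_right_mono) auto
  also have "\<dots> = 1 * 1 * (1 + M * (\<bar>B\<bar> + \<bar>c\<bar>))" by simp
  also have "\<dots> \<le> q * P * (1 + M * (\<bar>B\<bar> + \<bar>c\<bar>))"
    using assms(2) \<open>1 * 1 \<le> q * P\<close> by (intro mult_right_mono) auto
  also have "\<dots> = h - c" by (simp only: h_def add_diff_cancel_left')
  finally have "h > B" by arith
  moreover have "coprime M h"
  proof (rule ccontr)
    assume "\<not> coprime M h"
    then have "gcd M h \<noteq> 0" "\<not> gcd M h dvd 1" using assms(2) by auto
    then obtain p where "p dvd gcd M h" "Factorial_Ring.prime p" using prime_divisor_exists by blast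
    then have p: "Factorial_Ring.prime p" "p dvd M" "p dvd h" by auto
    show False
    proof (cases "p dvd c")
      case True
      then have "p dvd q * P * (1 + M * (\<bar>B\<bar> + \<bar>c\<bar>))"
        using p(3) by (simp add: h_def dvd_add_right_iff)
      moreover have "\<not> p dvd q" using cop p True by blast
      moreover have "\<not> p dvd P"
        unfolding P_def using p(1) True
        by (auto simp: prime_dvd_prod_iff in_prime_factors_iff dest: primes_dvd_imp_eq)
      moreover have "\<not> p dvd 1 + M * (\<bar>B\<bar> + \<bar>c\<bar>)"
        using p(2) prime_gt_1_int[OF p(1)] by (simp add: dvd_add_left_iff)
      ultimately show False using p(1) by (simp add: prime_dvd_mult_iff)
    next
      case False
      then have "p dvd P" unfolding P_def
        using p assms(2) by (intro dvd_prodI) (auto simp: in_prime_factors_iff)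
      then have "p dvd q * P * (1 + M * (\<bar>B\<bar> + \<bar>c\<bar>))" by simp
      then show False using False p(3) by (simp add: h_def dvd_add_left_iff)
    qed
  qed
  ultimately show ?thesis by (intro exI[of _ h]) (simp add: h_def)
qed

text \<open>As \<open>M\<close> and \<open>h\<close> are coprime, the gcd of \<open>q * M\<close>
  and the group order \<open>q * h\<close> is \<open>q\<close>. The torsion generator is reduced
  modulo \<open>q * h\<close> for the case \<open>q = 1\<close>, where it must be 0;
  \<open>h > 1\<close> puts 1 into the carrier.\<close>

lemma int_mod_cyclic_frame:
  fixes q h M :: int
  assumes "q > 0" "M > 0" "h > 1" "coprime M h"
  shows "cyclic_frame (integer_mod_group (nat (q * h))) (q * M) q 1 (h mod (q * h))"
proof -
  let ?Z = "integer_mod_group (nat (q * h))"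
  have n: "int (nat (q * h)) = q * h" "0 < q * h" using assms by auto
  have n1: "1 < q * h" using assms by (smt (verit) mult_le_cancel_right1)
  have car: "carrier ?Z = {0..<q * h}" using n by (simp add: carrier_integer_mod_group)
  have pow: "x [^]\<^bsub>?Z\<^esub> (i::int) = (i * x) mod (q * h)" for x i
    unfolding int_pow_integer_mod_group n(1) ..
  have pow_h: "(h mod (q * h)) [^]\<^bsub>?Z\<^esub> (i::int) = (i * h) mod (q * h)" for i
    unfolding pow by (rule mod_mult_right_eq)
  \<comment> \<open>\<open>a\<close> inverts \<open>M\<close> modulo \<open>h\<close>, which makes
    each multiple of \<open>q\<close> a multiple of \<open>q * M\<close> modulo
    \<open>q * h\<close>.\<close>
  obtain a b where ab: "a * M + b * h = 1" using assms(4) by (metis bezout_int coprime_imp_gcd_eq_1)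
  show ?thesis
    unfolding cyclic_frame_def
  proof (intro conjI ballI allI impI)
    fix x assume x: "x \<in> carrier ?Z"
    show "\<exists>j::int. \<exists>y\<in>carrier ?Z. x = 1 [^]\<^bsub>?Z\<^esub> j \<otimes>\<^bsub>?Z\<^esub> y [^]\<^bsub>?Z\<^esub> (q * M)"
      using x car n by (intro exI[of _ x] bexI[of _ 0]) (auto simp: pow)
    assume "x [^]\<^bsub>?Z\<^esub> (q * M) = \<one>\<^bsub>?Z\<^esub>"
    then have "q * h dvd q * (M * x)" by (simp add: pow mod_eq_0_iff_dvd mult.assoc)
    then have "h dvd M * x" using assms by simp
    then have "h dvd x" using assms(4) by (simp add: coprime_commute coprime_dvd_mult_right_iff)
    then obtain i where "x = h * i" by blast
    then have "x = (i * h) mod (q * h)" using x car by (simp only: mult.commute[of i h]) simp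
    then show "\<exists>i::int. x = (h mod (q * h)) [^]\<^bsub>?Z\<^esub> i" unfolding pow_h by blast
  next
    fix j :: int
    show "1 [^]\<^bsub>?Z\<^esub> j \<in> powers ?Z (q * M) \<longleftrightarrow> q dvd j"
    proof
      assume "1 [^]\<^bsub>?Z\<^esub> j \<in> powers ?Z (q * M)"
      then obtain y where "j mod (q * h) = (q * M * y) mod (q * h)" by (auto simp: powers_def pow)
      then have "q * h dvd j - q * M * y" unfolding mod_eq_dvd_iff .
      then have "q dvd j - q * M * y" by (rule dvd_mult_left)
      moreover have "q dvd q * M * y" by simp
      ultimately show "q dvd j" by (metis dvd_diff_commute dvd_add_right_iff diff_add_cancel)
    next
      assume "q dvd j"
      then obtain i where i: "j = q * i" by blast
      have "j = q * M * (a * i) + q * h * (b * i)"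
      proof -
        have "j = q * (i * (a * M + b * h))" using i ab by simp
        then show ?thesis by (simp add: algebra_simps)
      qed
      then have "j mod (q * h) = (q * M * ((a * i) mod (q * h))) mod (q * h)" by (simp add: mod_simps)
      then show "1 [^]\<^bsub>?Z\<^esub> j \<in> powers ?Z (q * M)"
        unfolding powers_def using n by (intro image_eqI[of _ _ "(a * i) mod (q * h)"]) (auto simp: pow car)
    qed
    show "(h mod (q * h)) [^]\<^bsub>?Z\<^esub> j = \<one>\<^bsub>?Z\<^esub> \<longleftrightarrow> q dvd j"
      unfolding pow_h using assms by (simp only: one_integer_mod_group mod_eq_0_iff_dvd) simp
  qed (use assms n n1 in \<open>simp_all add: car del: integer_mod_group_1\<close>)
qed

section \<open>Starting positions and the invariants \<open>q\<close> and \<open>c\<close>\<close>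

definition frame_env :: "('a, 'b) monoid_scheme \<Rightarrow> nat \<Rightarrow> 'a \<Rightarrow> 'a \<Rightarrow> nat \<Rightarrow> 'a" where
  "frame_env G K g t = (\<lambda>_. \<one>\<^bsub>G\<^esub>)(K := g, K + 1 := t)"

lemma (in comm_group) comb_frame_env:
  assumes "g \<in> carrier G" "t \<in> carrier G"
  shows "comb G (frame_env G K g t) m (K + 2) = g [^] m K \<otimes> t [^] m (K + 1)"
proof -
  have "comb G (frame_env G K g t) m k = \<one>" if "k \<le> K" for k
    using that by (induction k) (auto simp: frame_env_def comb.simps(2))
  then show ?thesis using assms by (simp add: comb.simps(2) frame_env_def)
qed

lemma range_frame_env:
  "monoid G \<Longrightarrow> g \<in> carrier G \<Longrightarrow> t \<in> carrier G \<Longrightarrow> range (frame_env G K g t) \<subseteq> carrier G"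
  by (auto simp: frame_env_def)

lemma framed_frame_env:
  assumes "cyclic_frame G \<Lambda> q g t"
  shows "framed K \<Lambda> G (frame_env G K g t)"
proof -
  have "range (frame_env G K g t) \<subseteq> carrier G"
    using assms by (intro range_frame_env) (auto simp: cyclic_frame_def comm_group_def group_def)
  moreover have "frame_env G K g t K = g" "frame_env G K g t (K + 1) = t" by (auto simp: frame_env_def)
  ultimately show ?thesis
    using assms unfolding framed_def cyclic_frame_def by (simp only:) blast
qed

text \<open>Modulo \<open>n\<close>-th powers \<open>t\<close> is \<open>g ^ c\<close>, which leaves
  a power of \<open>g\<close>, and \<open>g\<close> has order \<open>gcd d q\<close> modulo
  \<open>d\<close>-th powers. So divisibility at the starting position depends on \<open>q\<close>
  and \<open>c\<close> alone.\<close>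

lemma cyclic_frame_powers_iff:
  assumes fr: "cyclic_frame G n q g t" and y: "y \<in> carrier G" "t = g [^]\<^bsub>G\<^esub> (c::int) \<otimes>\<^bsub>G\<^esub> y [^]\<^bsub>G\<^esub> n"
    and d: "d dvd n"
  shows "g [^]\<^bsub>G\<^esub> j \<otimes>\<^bsub>G\<^esub> t [^]\<^bsub>G\<^esub> i \<in> powers G d \<longleftrightarrow> gcd d q dvd j + c * i"
proof -
  interpret G: comm_group G using fr by (simp add: cyclic_frame_def)
  have g: "g \<in> carrier G" and gen: "\<And>x. x \<in> carrier G \<Longrightarrow> \<exists>j::int. \<exists>y\<in>carrier G. x = g [^]\<^bsub>G\<^esub> j \<otimes>\<^bsub>G\<^esub> y [^]\<^bsub>G\<^esub> n"
    and pw: "\<And>j::int. g [^]\<^bsub>G\<^esub> j \<in> powers G n \<longleftrightarrow> q dvd j"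
    using fr by (auto simp: cyclic_frame_def)
  let ?s = "j + c * i"
  have "g [^]\<^bsub>G\<^esub> j \<otimes>\<^bsub>G\<^esub> t [^]\<^bsub>G\<^esub> i = g [^]\<^bsub>G\<^esub> ?s \<otimes>\<^bsub>G\<^esub> y [^]\<^bsub>G\<^esub> (n * i)"
    using y g by (simp add: G.int_pow_distrib G.int_pow_pow G.int_pow_mult G.m_assoc)
  moreover have "y [^]\<^bsub>G\<^esub> (n * i) \<in> powers G d" using d y(1) by (intro G.int_pow_in_powers) auto
  ultimately have "g [^]\<^bsub>G\<^esub> j \<otimes>\<^bsub>G\<^esub> t [^]\<^bsub>G\<^esub> i \<in> powers G d \<longleftrightarrow> g [^]\<^bsub>G\<^esub> ?s \<in> powers G d"
    using G.powers_mult_iff g by simp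
  also have "\<dots> \<longleftrightarrow> gcd d q dvd ?s"
  proof
    assume "g [^]\<^bsub>G\<^esub> ?s \<in> powers G d"
    then obtain w where w: "w \<in> carrier G" "g [^]\<^bsub>G\<^esub> ?s = w [^]\<^bsub>G\<^esub> d" by (auto simp: powers_def)
    then obtain k :: int and v where v: "v \<in> carrier G" "w = g [^]\<^bsub>G\<^esub> k \<otimes>\<^bsub>G\<^esub> v [^]\<^bsub>G\<^esub> n" using gen by blast
    have eq: "g [^]\<^bsub>G\<^esub> ?s = v [^]\<^bsub>G\<^esub> (n * d) \<otimes>\<^bsub>G\<^esub> g [^]\<^bsub>G\<^esub> (k * d)"
      using w v g by (simp add: G.int_pow_distrib G.int_pow_pow G.m_comm)
    have "g [^]\<^bsub>G\<^esub> (?s - k * d) = v [^]\<^bsub>G\<^esub> (n * d)"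
      unfolding G.int_pow_diff[OF g] eq using v g by (simp add: G.m_assoc)
    then have "g [^]\<^bsub>G\<^esub> (?s - k * d) \<in> powers G n" using v G.int_pow_in_powers[of n "n * d" v] by simp
    then have "q dvd ?s - k * d" using pw by blast
    then have "gcd d q dvd ?s - k * d" by (meson dvd_trans gcd_dvd2)
    moreover have "gcd d q dvd k * d" by simp
    ultimately have "gcd d q dvd (?s - k * d) + k * d" by (rule dvd_add)
    then show "gcd d q dvd ?s" by simp
  next
    assume "gcd d q dvd ?s"
    then obtain k where k: "?s = gcd d q * k" by blast
    obtain a b where "a * d + b * q = gcd d q" by (metis bezout_int)
    then have "?s = (a * d + b * q) * k" using k by simp
    then have "?s = d * (a * k) + q * (b * k)" by (simp add: algebra_simps)
    then have "g [^]\<^bsub>G\<^esub> ?s = g [^]\<^bsub>G\<^esub> (d * (a * k)) \<otimes>\<^bsub>G\<^esub> g [^]\<^bsub>G\<^esub> (q * (b * k))" using g G.int_pow_mult by metis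
    moreover have "g [^]\<^bsub>G\<^esub> (d * (a * k)) \<in> powers G d" using g by (intro G.int_pow_in_powers) auto
    moreover have "g [^]\<^bsub>G\<^esub> (q * (b * k)) \<in> powers G d" using pw G.powers_antimono[OF d] by auto
    ultimately show "g [^]\<^bsub>G\<^esub> ?s \<in> powers G d" using G.powers_mult by simp
  qed
  finally show ?thesis .
qed

text \<open>This leaves, at the starting position, only the bounded equations forced by the order of
  \<open>t\<close>, hence the same ones in \<open>A\<close> and its companion.\<close>

definition independent_frame :: "('a, 'b) monoid_scheme \<Rightarrow> int \<Rightarrow> 'a \<Rightarrow> 'a \<Rightarrow> bool" where
  "independent_frame G N g t \<longleftrightarrow> (\<forall>l i::int. 0 < \<bar>l\<bar> \<longrightarrow> \<bar>l\<bar> \<le> N \<longrightarrow> g [^]\<^bsub>G\<^esub> l \<noteq> t [^]\<^bsub>G\<^esub> i)"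

lemma independent_frame_eq_one_iff:
  assumes fr: "cyclic_frame G n q g t" and ind: "independent_frame G N g t" and j: "\<bar>j\<bar> \<le> N"
  shows "g [^]\<^bsub>G\<^esub> j \<otimes>\<^bsub>G\<^esub> t [^]\<^bsub>G\<^esub> (i::int) = \<one>\<^bsub>G\<^esub> \<longleftrightarrow> j = 0 \<and> q dvd i"
proof -
  interpret G: comm_group G using fr by (simp add: cyclic_frame_def)
  have g: "g \<in> carrier G" and t: "t \<in> carrier G" and tq: "\<And>i::int. t [^]\<^bsub>G\<^esub> i = \<one>\<^bsub>G\<^esub> \<longleftrightarrow> q dvd i"
    using fr by (auto simp: cyclic_frame_def)
  show ?thesis
  proof (cases "j = 0")
    case True
    then show ?thesis using t tq by simp
  next
    case False
    have "g [^]\<^bsub>G\<^esub> j \<noteq> t [^]\<^bsub>G\<^esub> (- i)" using ind j False unfolding independent_frame_def by simp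
    then have "g [^]\<^bsub>G\<^esub> j \<otimes>\<^bsub>G\<^esub> t [^]\<^bsub>G\<^esub> i \<noteq> \<one>\<^bsub>G\<^esub>"
      using g t by (simp add: G.int_pow_neg) (metis G.int_pow_closed G.inv_equality G.inv_inv)
    then show ?thesis using False by simp
  qed
qed

lemma similar_frame_env:
  assumes G: "cyclic_frame G \<Lambda> q g t" "independent_frame G N g t"
      "y \<in> carrier G" "t = g [^]\<^bsub>G\<^esub> (c::int) \<otimes>\<^bsub>G\<^esub> y [^]\<^bsub>G\<^esub> \<Lambda>"
    and H: "cyclic_frame H \<Lambda> q g' t'" "independent_frame H N g' t'"
      "y' \<in> carrier H" "t' = g' [^]\<^bsub>H\<^esub> c \<otimes>\<^bsub>H\<^esub> y' [^]\<^bsub>H\<^esub> \<Lambda>"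
  shows "similar K N \<Lambda> G (frame_env G K g t) H (frame_env H K g' t')"
proof -
  have "comb G (frame_env G K g t) m (K + 2) = g [^]\<^bsub>G\<^esub> m K \<otimes>\<^bsub>G\<^esub> t [^]\<^bsub>G\<^esub> m (K + 1)"
    "comb H (frame_env H K g' t') m (K + 2) = g' [^]\<^bsub>H\<^esub> m K \<otimes>\<^bsub>H\<^esub> t' [^]\<^bsub>H\<^esub> m (K + 1)" for m
    by (rule comm_group.comb_frame_env; use G(1) H(1) in \<open>simp add: cyclic_frame_def\<close>)+
  then show ?thesis
    unfolding similar_def coeffs_le_def
    using independent_frame_eq_one_iff[OF G(1,2)] independent_frame_eq_one_iff[OF H(1,2)]
      cyclic_frame_powers_iff[OF G(1,3,4)] cyclic_frame_powers_iff[OF H(1,3,4)] by simp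
qed

text \<open>A factor \<open>y ^ \<Lambda>\<close> does not change the class of \<open>g\<close>. A
  relation \<open>g' ^ l = t ^ i\<close> gives \<open>g' ^ (l * \<Lambda>) = 1\<close> and so
  prescribes \<open>y ^ (\<Lambda> * \<Lambda> * l)\<close>. The frames at these exponents make the
  torsion finite, so an infinite group has a \<open>y\<close> avoiding all relations up to
  \<open>N\<close>.\<close>

lemma independent_generator:
  assumes frames: "\<And>n. n > 0 \<Longrightarrow> \<exists>q g t. cyclic_frame G n q g t" and inf: "infinite (carrier G)"
    and fr: "cyclic_frame G \<Lambda> q g t"
  shows "\<exists>g'. cyclic_frame G \<Lambda> q g' t \<and> independent_frame G N g' t"
proof -
  interpret G: comm_group G using fr by (simp add: cyclic_frame_def)
  have g: "g \<in> carrier G" and t: "t \<in> carrier G" and \<Lambda>: "\<Lambda> > 0" and q: "q dvd \<Lambda>"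
    and tq: "\<And>i::int. t [^]\<^bsub>G\<^esub> i = \<one>\<^bsub>G\<^esub> \<longleftrightarrow> q dvd i"
    and pw: "\<And>j::int. g [^]\<^bsub>G\<^esub> j \<in> powers G \<Lambda> \<longleftrightarrow> q dvd j"
    and gen: "\<And>x. x \<in> carrier G \<Longrightarrow> \<exists>j::int. \<exists>y\<in>carrier G. x = g [^]\<^bsub>G\<^esub> j \<otimes>\<^bsub>G\<^esub> y [^]\<^bsub>G\<^esub> \<Lambda>"
    using fr by (auto simp: cyclic_frame_def)
  define B where "B l = {y \<in> carrier G. y [^]\<^bsub>G\<^esub> (\<Lambda> * \<Lambda> * l) = g [^]\<^bsub>G\<^esub> (- l * \<Lambda>)}" for l
  have "finite (B l)" if "l \<in> {1..N}" for l
  proof -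
    have pos: "\<Lambda> * \<Lambda> * l > 0" using \<Lambda> that by simp
    then obtain q' g' t' where fr': "cyclic_frame G (\<Lambda> * \<Lambda> * l) q' g' t'" using frames by blast
    have "t' [^]\<^bsub>G\<^esub> (\<Lambda> * \<Lambda> * l) = \<one>\<^bsub>G\<^esub>" using fr' unfolding cyclic_frame_def by blast
    moreover have "t' \<in> carrier G" "\<And>x. x \<in> carrier G \<Longrightarrow> x [^]\<^bsub>G\<^esub> (\<Lambda> * \<Lambda> * l) = \<one>\<^bsub>G\<^esub> \<Longrightarrow> \<exists>i::int. x = t' [^]\<^bsub>G\<^esub> i"
      using fr' unfolding cyclic_frame_def by blast+
    ultimately show ?thesis unfolding B_def
      by (intro G.finite_roots(1)[OF pos dvd_refl]) (use g in auto)
  qed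
  then have "finite (\<Union>l\<in>{1..N}. B l)" by blast
  then obtain y where y: "y \<in> carrier G" "y \<notin> (\<Union>l\<in>{1..N}. B l)"
    using inf by (meson finite_subset subsetI)
  define g' where "g' = g \<otimes>\<^bsub>G\<^esub> y [^]\<^bsub>G\<^esub> \<Lambda>"
  have g': "g' \<in> carrier G" using g y by (simp add: g'_def)
  have pow: "g' [^]\<^bsub>G\<^esub> j = g [^]\<^bsub>G\<^esub> j \<otimes>\<^bsub>G\<^esub> y [^]\<^bsub>G\<^esub> (\<Lambda> * j)" for j :: int
    using g y by (simp add: g'_def G.int_pow_distrib G.int_pow_pow)
  have not_torsion: "g' [^]\<^bsub>G\<^esub> (l * \<Lambda>) \<noteq> \<one>\<^bsub>G\<^esub>" if "l \<in> {1..N}" for l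
  proof
    assume "g' [^]\<^bsub>G\<^esub> (l * \<Lambda>) = \<one>\<^bsub>G\<^esub>"
    then have "y [^]\<^bsub>G\<^esub> (\<Lambda> * (l * \<Lambda>)) \<otimes>\<^bsub>G\<^esub> g [^]\<^bsub>G\<^esub> (l * \<Lambda>) = \<one>\<^bsub>G\<^esub>"
      using pow g y by (simp add: G.m_comm)
    then have "y [^]\<^bsub>G\<^esub> (\<Lambda> * (l * \<Lambda>)) = inv\<^bsub>G\<^esub> (g [^]\<^bsub>G\<^esub> (l * \<Lambda>))"
      using g y by (metis G.int_pow_closed G.inv_equality)
    then have "y \<in> B l" using y(1) g by (simp add: B_def mult.commute mult.left_commute G.int_pow_neg)
    then show False using y(2) that by blast
  qed
  have "independent_frame G N g' t"
    unfolding independent_frame_def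
  proof (intro allI impI notI)
    fix l i :: int assume l: "0 < \<bar>l\<bar>" "\<bar>l\<bar> \<le> N" and eq: "g' [^]\<^bsub>G\<^esub> l = t [^]\<^bsub>G\<^esub> i"
    have "g' [^]\<^bsub>G\<^esub> (\<bar>l\<bar> * \<Lambda>) = (g' [^]\<^bsub>G\<^esub> l) [^]\<^bsub>G\<^esub> (sgn l * \<Lambda>)"
      using g' by (simp add: G.int_pow_pow abs_sgn flip: mult.assoc)
    also have "\<dots> = \<one>\<^bsub>G\<^esub>" unfolding eq using t q by (simp add: G.int_pow_pow tq)
    finally show False using not_torsion[of "\<bar>l\<bar>"] l by simp
  qed
  moreover have "cyclic_frame G \<Lambda> q g' t"
  proof -
    have "g' [^]\<^bsub>G\<^esub> j \<in> powers G \<Lambda> \<longleftrightarrow> q dvd j" for j :: int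
      unfolding pow using pw G.powers_mult_iff[of "g [^]\<^bsub>G\<^esub> j"] G.int_pow_in_powers[of \<Lambda> "\<Lambda> * j" y] g y by simp
    moreover have "\<exists>j::int. \<exists>z\<in>carrier G. x = g' [^]\<^bsub>G\<^esub> j \<otimes>\<^bsub>G\<^esub> z [^]\<^bsub>G\<^esub> \<Lambda>" if x: "x \<in> carrier G" for x
    proof -
      obtain j :: int and z where z: "z \<in> carrier G" "x = g [^]\<^bsub>G\<^esub> j \<otimes>\<^bsub>G\<^esub> z [^]\<^bsub>G\<^esub> \<Lambda>" using gen x by blast
      have "x = g' [^]\<^bsub>G\<^esub> j \<otimes>\<^bsub>G\<^esub> (inv\<^bsub>G\<^esub> (y [^]\<^bsub>G\<^esub> j) \<otimes>\<^bsub>G\<^esub> z) [^]\<^bsub>G\<^esub> \<Lambda>"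
        unfolding pow z(2) using g y(1) z(1)
        by (simp add: G.int_pow_distrib G.int_pow_inv G.int_pow_pow mult.commute G.m_assoc)
           (simp add: G.r_inv flip: G.m_assoc)
      then show ?thesis using y(1) z(1) by (intro exI[of _ j] bexI[of _ "inv\<^bsub>G\<^esub> (y [^]\<^bsub>G\<^esub> j) \<otimes>\<^bsub>G\<^esub> z"]) auto
    qed
    ultimately show ?thesis using fr g' unfolding cyclic_frame_def by blast
  qed
  ultimately show ?thesis by blast
qed

lemma cyclic_companion:
  assumes fr: "cyclic_frame G \<Lambda> q g t" and y: "y \<in> carrier G" "t = g [^]\<^bsub>G\<^esub> (c::int) \<otimes>\<^bsub>G\<^esub> y [^]\<^bsub>G\<^esub> \<Lambda>"
  shows "\<exists>n g' t' y'. n > 0 \<and> B < int n \<and> cyclic_frame (integer_mod_group n) \<Lambda> q g' t' \<and>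
    independent_frame (integer_mod_group n) N g' t' \<and> y' \<in> carrier (integer_mod_group n) \<and>
    t' = g' [^]\<^bsub>integer_mod_group n\<^esub> c \<otimes>\<^bsub>integer_mod_group n\<^esub> y' [^]\<^bsub>integer_mod_group n\<^esub> \<Lambda>"
proof -
  interpret G: comm_group G using fr by (simp add: cyclic_frame_def)
  have g: "g \<in> carrier G" and t: "t \<in> carrier G" and \<Lambda>: "\<Lambda> > 0" and q: "q > 0" "q dvd \<Lambda>"
    and tq: "\<And>i::int. t [^]\<^bsub>G\<^esub> i = \<one>\<^bsub>G\<^esub> \<longleftrightarrow> q dvd i"
    and tgen: "\<And>x. x \<in> carrier G \<Longrightarrow> x [^]\<^bsub>G\<^esub> \<Lambda> = \<one>\<^bsub>G\<^esub> \<Longrightarrow> \<exists>i::int. x = t [^]\<^bsub>G\<^esub> i"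
    using fr by (auto simp: cyclic_frame_def)
  obtain M where M: "\<Lambda> = q * M" using q(2) by blast
  have M0: "M > 0" using M \<Lambda> q(1) by (metis zero_less_mult_pos)
  \<comment> \<open>Otherwise \<open>t\<close> has a \<open>p\<close>-th root \<open>z\<close>,
    itself \<Lambda>-torsion because \<open>p\<close> divides \<open>M\<close>. Then
    \<open>z\<close> is a power of \<open>t\<close>, and \<open>t\<close> is killed by
    \<open>q div p\<close>.\<close>
  have "\<not> p dvd c" if p: "Factorial_Ring.prime p" "p dvd M" "p dvd q" for p
  proof
    assume "p dvd c"
    then obtain c' where c': "c = p * c'" by blast
    obtain M' where M': "M = p * M'" using p(2) by blast
    obtain q' where q': "q = p * q'" using p(3) by blast
    have p1: "p > 1" using p(1) by (rule prime_gt_1_int)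
    define z where "z = g [^]\<^bsub>G\<^esub> c' \<otimes>\<^bsub>G\<^esub> y [^]\<^bsub>G\<^esub> (q * M')"
    have z: "z \<in> carrier G" using g y by (simp add: z_def)
    have zp: "z [^]\<^bsub>G\<^esub> p = t"
      using g y by (simp add: z_def c' M M' G.int_pow_distrib G.int_pow_pow mult_ac)
    have "z [^]\<^bsub>G\<^esub> \<Lambda> = (z [^]\<^bsub>G\<^esub> p) [^]\<^bsub>G\<^esub> (q * M')" using z by (simp add: G.int_pow_pow M M' mult_ac)
    also have "\<dots> = \<one>\<^bsub>G\<^esub>" by (simp add: zp tq)
    finally obtain i :: int where i: "z = t [^]\<^bsub>G\<^esub> i" using tgen z by blast
    have "t [^]\<^bsub>G\<^esub> q' = z [^]\<^bsub>G\<^esub> q" using z by (simp add: zp[symmetric] G.int_pow_pow q')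
    also have "\<dots> = \<one>\<^bsub>G\<^esub>" using t by (simp add: i G.int_pow_pow tq)
    finally have "q dvd q'" by (simp add: tq)
    moreover have "q' > 0" using q(1) q' p1 by (metis zero_less_mult_pos less_trans zero_less_one)
    ultimately have "q \<le> q'" by (rule zdvd_imp_le)
    then show False using q' p1 \<open>q' > 0\<close> by simp
  qed
  \<comment> \<open>The three lower bounds serve, in this order, the carrier, the independence of 1
    from the torsion, and the size of the group.\<close>
  from coprime_lift[OF q(1) M0 this, of "max 1 (max N B)"]
  obtain h where h: "h > max 1 (max N B)" "q dvd h - c" "coprime M h" by blast
  have h1: "h > 1" using h by simp
  define n where "n = nat (q * h)"
  let ?Z = "integer_mod_group n" and ?t = "h mod (q * h)"
  have n: "int n = q * h" "q * h > 0" using q h1 by (auto simp: n_def)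
  have hq: "h \<le> q * h" using q h1 by simp
  have frZ: "cyclic_frame ?Z \<Lambda> q 1 ?t" unfolding n_def M by (rule int_mod_cyclic_frame[OF q(1) M0 h1 h(3)])
  interpret Z: comm_group ?Z by simp
  have one: "1 \<in> carrier ?Z" using frZ by (simp only: cyclic_frame_def)
  have pow: "x [^]\<^bsub>?Z\<^esub> (i::int) = (i * x) mod (q * h)" for x i
    unfolding int_pow_integer_mod_group n(1) ..
  have "independent_frame ?Z N 1 ?t"
    unfolding independent_frame_def
  proof (intro allI impI notI)
    fix l i :: int assume l: "0 < \<bar>l\<bar>" "\<bar>l\<bar> \<le> N" and "1 [^]\<^bsub>?Z\<^esub> l = ?t [^]\<^bsub>?Z\<^esub> i"
    then have "l mod (q * h) = (i * h) mod (q * h)" unfolding pow mod_mult_right_eq by simp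
    then have "q * h dvd l - i * h" unfolding mod_eq_dvd_iff .
    then have "h dvd l - i * h" by (rule dvd_mult_right)
    then have "h dvd (l - i * h) + i * h" by (intro dvd_add) auto
    then have "\<bar>h\<bar> \<le> \<bar>l\<bar>" using l by (intro dvd_imp_le_int) auto
    then show False using l h(1) by simp
  qed
  moreover have "\<exists>y'\<in>carrier ?Z. ?t = 1 [^]\<^bsub>?Z\<^esub> c \<otimes>\<^bsub>?Z\<^esub> y' [^]\<^bsub>?Z\<^esub> \<Lambda>"
  proof -
    \<comment> \<open>\<open>?t\<close> is \<open>h\<close> times the generator 1, and
      \<open>h - c\<close> is a multiple of \<open>q\<close>, hence a \<Lambda>-th power in additive
      form.\<close>
    have "1 [^]\<^bsub>?Z\<^esub> (h - c) \<in> powers ?Z \<Lambda>" using frZ h(2) unfolding cyclic_frame_def by blast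
    then obtain y' where y': "y' \<in> carrier ?Z" "1 [^]\<^bsub>?Z\<^esub> (h - c) = y' [^]\<^bsub>?Z\<^esub> \<Lambda>" by (auto simp only: powers_def)
    have "?t = 1 [^]\<^bsub>?Z\<^esub> (c + (h - c))" unfolding pow by simp
    also have "\<dots> = 1 [^]\<^bsub>?Z\<^esub> c \<otimes>\<^bsub>?Z\<^esub> y' [^]\<^bsub>?Z\<^esub> \<Lambda>"
      unfolding y'(2)[symmetric] by (rule Z.int_pow_mult[OF one])
    finally show ?thesis using y'(1) by blast
  qed
  moreover have "n > 0" using n by linarith
  moreover have "B < int n" unfolding n(1) using h(1) hq by linarith
  ultimately show ?thesis using frZ by blast
qed

section \<open>Transfer of first-order sentences\<close>

text \<open>Quantified variables count as well, since no quantifier may overwrite the frame at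
  \<open>K\<close> and \<open>K + 1\<close>.\<close>

primrec vars_below :: "nat \<Rightarrow> group_formula \<Rightarrow> bool" where
  "vars_below K (Eq s t) \<longleftrightarrow> term_vars s \<union> term_vars t \<subseteq> {..<K}"
| "vars_below K (Neg p) \<longleftrightarrow> vars_below K p"
| "vars_below K (Conj p q) \<longleftrightarrow> vars_below K p \<and> vars_below K q"
| "vars_below K (Exi v p) \<longleftrightarrow> v < K \<and> vars_below K p"

lemma vars_below_mono: "vars_below K p \<Longrightarrow> K \<le> K' \<Longrightarrow> vars_below K' p"
  by (induction p) auto

lemma finite_term_vars: "finite (term_vars t)"
  by (induction t) auto

lemma ex_vars_below: "\<exists>K. vars_below K p"
proof (induction p)
  case (Eq s t)
  have "finite (term_vars s \<union> term_vars t)" by (simp add: finite_term_vars)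
  then show ?case using finite_nat_iff_bounded by simp
next
  case (Conj p q)
  then obtain K K' where "vars_below K p" "vars_below K' q" by blast
  then have "vars_below (max K K') (Conj p q)" by (auto intro: vars_below_mono)
  then show ?case by blast
next
  case (Exi v p)
  then obtain K where "vars_below K p" by blast
  then have "vars_below (max K (Suc v)) (Exi v p)" by (auto intro: vars_below_mono)
  then show ?case by blast
qed simp

primrec term_coeffs :: "group_term \<Rightarrow> nat \<Rightarrow> int" where
  "term_coeffs (Var v) = (\<lambda>i. if i = v then 1 else 0)"
| "term_coeffs One = (\<lambda>i. 0)"
| "term_coeffs (Mul s t) = (\<lambda>i. term_coeffs s i + term_coeffs t i)"
| "term_coeffs (Inv t) = (\<lambda>i. - term_coeffs t i)"

lemma (in comm_group) term_val_eq_comb: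
  assumes "range e \<subseteq> carrier G" "term_vars t \<subseteq> {..<k}"
  shows "term_val G e t = comb G e (term_coeffs t) k"
  using assms(2)
proof (induction t)
  case (Var v)
  then show ?case using comb_single[OF assms(1), of v k 1] assms(1) by (simp add: image_subset_iff)
next
  case One
  have "comb G e (\<lambda>i. 0) k = \<one>" by (induction k) (simp_all add: comb.simps(2))
  then show ?case by simp
qed (use assms(1) in \<open>auto simp: comb_add comb_uminus\<close>)

text \<open>\<open>N\<close> and \<open>L\<close> are fixed before \<Lambda> and the groups, so the
  companion can be chosen afterwards. An equality of terms is one bounded equation; each quantifier
  consumes precision through \<open>forth\<close>, applied in both directions.\<close>

lemma sat_transfer:
  assumes "vars_below K p"
  shows "\<exists>N L. N \<ge> 1 \<and> L \<ge> 1 \<and> (\<forall>\<Lambda> (G :: ('a, 'b) monoid_scheme) (H :: ('c, 'd) monoid_scheme) e f.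
    L dvd \<Lambda> \<longrightarrow> framed K \<Lambda> G e \<longrightarrow> framed K \<Lambda> H f \<longrightarrow> large K N \<Lambda> G \<longrightarrow> large K N \<Lambda> H \<longrightarrow>
    similar K N L G e H f \<longrightarrow> (sat G e p \<longleftrightarrow> sat H f p))"
  using assms
proof (induction p)
  case (Eq s t)
  define m where "m i = term_coeffs s i + - term_coeffs t i" for i
  define N where "N = 1 + (\<Sum>i\<le>K. \<bar>m i\<bar>)"
  have N: "N \<ge> 1" by (simp add: N_def sum_nonneg)
  have m: "coeffs_le K N m"
    unfolding coeffs_le_def N_def using member_le_sum[of _ "{..K}" "\<lambda>i. \<bar>m i\<bar>"]
    by (simp add: add_increasing)
  have eq: "sat G e (Eq s t) \<longleftrightarrow> comb G e m (K + 2) = \<one>\<^bsub>G\<^esub>" if "framed K \<Lambda> G e"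
    for G :: "('x, 'y) monoid_scheme" and e \<Lambda>
  proof -
    interpret G: comm_group G using that by (simp add: framed_def)
    have e: "range e \<subseteq> carrier G" using that by (simp add: framed_def)
    have "term_vars s \<subseteq> {..<K + 2}" "term_vars t \<subseteq> {..<K + 2}" using Eq by auto
    then have "term_val G e s = comb G e (term_coeffs s) (K + 2)" "term_val G e t = comb G e (term_coeffs t) (K + 2)"
      using G.term_val_eq_comb[OF e] by blast+
    moreover have "comb G e m (K + 2) =
        comb G e (term_coeffs s) (K + 2) \<otimes>\<^bsub>G\<^esub> inv\<^bsub>G\<^esub> (comb G e (term_coeffs t) (K + 2))"
      unfolding m_def by (simp only: G.comb_add[OF e] G.comb_uminus[OF e])
    ultimately show ?thesis
      using G.comb_closed[OF e] by (simp add: G.inv_solve_right')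
  qed
  show ?case
  proof (rule exI[of _ N], rule exI[of _ 1], intro conjI allI impI)
    fix \<Lambda> and G :: "('a, 'b) monoid_scheme" and H :: "('c, 'd) monoid_scheme" and e f
    assume "framed K \<Lambda> G e" "framed K \<Lambda> H f" "similar K N 1 G e H f"
    then show "sat G e (Eq s t) \<longleftrightarrow> sat H f (Eq s t)" using eq m unfolding similar_def by metis
  qed (use N in auto)
next
  case (Neg p)
  then show ?case by simp
next
  case (Conj p q)
  obtain N1 L1 where 1: "N1 \<ge> 1" "L1 \<ge> 1" "\<And>\<Lambda> (G :: ('a, 'b) monoid_scheme) (H :: ('c, 'd) monoid_scheme) e f.
    L1 dvd \<Lambda> \<Longrightarrow> framed K \<Lambda> G e \<Longrightarrow> framed K \<Lambda> H f \<Longrightarrow> large K N1 \<Lambda> G \<Longrightarrow> large K N1 \<Lambda> H \<Longrightarrow>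
    similar K N1 L1 G e H f \<Longrightarrow> (sat G e p \<longleftrightarrow> sat H f p)"
    using Conj.IH(1) Conj.prems by fastforce
  obtain N2 L2 where 2: "N2 \<ge> 1" "L2 \<ge> 1" "\<And>\<Lambda> (G :: ('a, 'b) monoid_scheme) (H :: ('c, 'd) monoid_scheme) e f.
    L2 dvd \<Lambda> \<Longrightarrow> framed K \<Lambda> G e \<Longrightarrow> framed K \<Lambda> H f \<Longrightarrow> large K N2 \<Lambda> G \<Longrightarrow> large K N2 \<Lambda> H \<Longrightarrow>
    similar K N2 L2 G e H f \<Longrightarrow> (sat G e q \<longleftrightarrow> sat H f q)"
    using Conj.IH(2) Conj.prems by fastforce
  show ?case
  proof (rule exI[of _ "max N1 N2"], rule exI[of _ "L1 * L2"], intro conjI allI impI)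
    fix \<Lambda> and G :: "('a, 'b) monoid_scheme" and H :: "('c, 'd) monoid_scheme" and e f
    assume "L1 * L2 dvd \<Lambda>" and fr: "framed K \<Lambda> G e" "framed K \<Lambda> H f"
      and large: "large K (max N1 N2) \<Lambda> G" "large K (max N1 N2) \<Lambda> H"
      and sim: "similar K (max N1 N2) (L1 * L2) G e H f"
    then have dvd: "L1 dvd \<Lambda>" "L2 dvd \<Lambda>" by (auto dest: dvd_mult_left dvd_mult_right)
    have N: "0 \<le> N1" "N1 \<le> max N1 N2" "0 \<le> N2" "N2 \<le> max N1 N2" using 1(1) 2(1) by auto
    show "sat G e (Conj p q) \<longleftrightarrow> sat H f (Conj p q)"
      using 1(3)[OF dvd(1) fr large_mono[OF large(1) N(1,2)] large_mono[OF large(2) N(1,2)] similar_mono[OF sim N(2)]]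
        2(3)[OF dvd(2) fr large_mono[OF large(1) N(3,4)] large_mono[OF large(2) N(3,4)] similar_mono[OF sim N(4)]]
      by simp
  qed (use 1(1,2) 2(1,2) mult_mono[of 1 L1 1 L2] in auto)
next
  case (Exi v p)
  obtain N L where IH: "N \<ge> 1" "L \<ge> 1" "\<And>\<Lambda> (G :: ('a, 'b) monoid_scheme) (H :: ('c, 'd) monoid_scheme) e f.
    L dvd \<Lambda> \<Longrightarrow> framed K \<Lambda> G e \<Longrightarrow> framed K \<Lambda> H f \<Longrightarrow> large K N \<Lambda> G \<Longrightarrow> large K N \<Lambda> H \<Longrightarrow>
    similar K N L G e H f \<Longrightarrow> (sat G e p \<longleftrightarrow> sat H f p)"
    using Exi.IH Exi.prems by fastforce
  have v: "v < K" using Exi.prems by simp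
  \<comment> \<open>\<open>forth\<close> extracts \<open>L * r\<close>-th roots for \<open>r\<close>
    up to \<open>N\<close>; the factorial makes all these numbers divide \<open>L'\<close>.\<close>
  define N' L' where "N' = step_bound N" and "L' = L * fact (nat N)"
  have "0 \<le> combination_bound N (nat N)" using combination_bound_mono[OF IH(1), of 0 "nat N"] IH(1) by simp
  then have NN': "N \<le> N'" unfolding N'_def step_bound_def using IH(1) by simp
  have L'_dvd: "L * r dvd L'" if "1 \<le> r" "r \<le> N" for r
  proof -
    have "nat r dvd fact (nat N)" using that by (intro dvd_fact) auto
    then have "int (nat r) dvd int (fact (nat N))" by (simp only: int_dvd_int_iff)
    then show ?thesis using that by (simp add: L'_def)
  qed
  show ?case
  proof (rule exI[of _ N'], rule exI[of _ L'], intro conjI allI impI)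
    fix \<Lambda> and G :: "('a, 'b) monoid_scheme" and H :: "('c, 'd) monoid_scheme" and e f
    assume L\<Lambda>: "L' dvd \<Lambda>" and fr: "framed K \<Lambda> G e" "framed K \<Lambda> H f"
      and large': "large K N' \<Lambda> G" "large K N' \<Lambda> H" and sim: "similar K N' L' G e H f"
    have large: "large K N \<Lambda> G" "large K N \<Lambda> H" using large' NN' IH(1) by (auto intro: large_mono)
    have "L dvd \<Lambda>" using L\<Lambda> L'_dvd[of 1] IH(1) by (auto intro: dvd_trans)
    then have step: "sat G (e(v := a)) p \<longleftrightarrow> sat H (f(v := b)) p"
      if "a \<in> carrier G" "b \<in> carrier H" "similar K N L G (e(v := a)) H (f(v := b))" for a b
      using IH(3) framed_upd[OF fr(1) v that(1)] framed_upd[OF fr(2) v that(2)] large that(3) by blast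
    show "sat G e (Exi v p) \<longleftrightarrow> sat H f (Exi v p)"
    proof
      assume "sat G e (Exi v p)"
      then obtain a where a: "a \<in> carrier G" "sat G (e(v := a)) p" by auto
      obtain b where "b \<in> carrier H" "similar K N L G (e(v := a)) H (f(v := b))"
        using forth[OF sim fr IH(1) _ L'_dvd L\<Lambda> large(2) a(1) v] by (auto simp: N'_def)
      then show "sat H f (Exi v p)" using step a by auto
    next
      assume "sat H f (Exi v p)"
      then obtain b where b: "b \<in> carrier H" "sat H (f(v := b)) p" by auto
      obtain a where "a \<in> carrier G" "similar K N L H (f(v := b)) G (e(v := a))"
        using forth[OF similar_sym[OF sim] fr(2,1) IH(1) _ L'_dvd L\<Lambda> large(1) b(1) v] by (auto simp: N'_def)
      then show "sat G e (Exi v p)" using step b similar_sym by fastforce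
    qed
  next
    show "1 \<le> N'" using NN' IH(1) by simp
    show "1 \<le> L'" unfolding L'_def using mult_mono[of 1 L 1 "fact (nat N)"] IH(2) by simp
  qed
qed

section \<open>Ultrafilters and compactness\<close>

text \<open>Zorn's lemma for proper filters below \<open>F\<close>, ordered downwards: the infimum
  of a chain is improper only if a member is. A minimal \<open>U\<close> decides each
  \<open>P\<close>, because restricting it to \<open>P\<close> gives an improper filter or
  \<open>U\<close> again.\<close>

lemma ex_ultrafilter_le:
  assumes "F \<noteq> (bot :: 'i filter)"
  shows "\<exists>U. ultrafilter U \<and> U \<le> F"
proof -
  let ?A = "{U. U \<noteq> bot \<and> U \<le> F}" and ?r = "\<lambda>U V. V \<le> (U :: 'i filter)"
  have "\<exists>m\<in>?A. \<forall>a\<in>?A. ?r m a \<longrightarrow> a = m"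
  proof (rule predicate_Zorn)
    show "partial_order_on ?A (relation_of ?r ?A)"
      by (rule partial_order_on_relation_ofI) auto
    fix C assume C: "C \<in> Chains (relation_of ?r ?A)"
    then have sub: "C \<subseteq> ?A" by (auto simp: Chains_def relation_of_def)
    have chain: "U \<le> V \<or> V \<le> U" if "U \<in> C" "V \<in> C" for U V
      using C that by (auto simp: Chains_def relation_of_def)
    show "\<exists>u\<in>?A. \<forall>a\<in>C. ?r a u"
    proof (cases "C = {}")
      case True
      then show ?thesis using assms by auto
    next
      case False
      have "\<exists>x\<in>C. x \<le> inf U V" if "U \<in> C" "V \<in> C" for U V using chain[OF that] that by auto
      then have "eventually (\<lambda>_. False) (Inf C) \<longleftrightarrow> (\<exists>b\<in>C. eventually (\<lambda>_. False) b)"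
        using False by (intro eventually_Inf_base) auto
      then have "Inf C \<noteq> bot" using sub by (auto simp: trivial_limit_def)
      moreover have "Inf C \<le> F" 
      proof -
        obtain U where "U \<in> C" using False by blast
        then show ?thesis using sub by (intro Inf_lower2[of U]) auto
      qed
      ultimately show ?thesis by (auto intro!: bexI[of _ "Inf C"] Inf_lower)
    qed
  qed
  then obtain U where U: "U \<noteq> bot" "U \<le> F" and max: "\<And>V. V \<noteq> bot \<Longrightarrow> V \<le> U \<Longrightarrow> V = U"
    by (auto dest: order_trans)
  have "eventually P U" if "\<not> eventually (\<lambda>i. \<not> P i) U" for P
  proof -
    have "inf U (principal {i. P i}) \<noteq> bot"
      using that by (auto simp: trivial_limit_def eventually_inf_principal)
    then have "inf U (principal {i. P i}) = U" using max by simp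
    moreover have "eventually P (inf U (principal {i. P i}))" by (simp add: eventually_inf_principal)
    ultimately show ?thesis by simp
  qed
  then have "ultrafilter U" unfolding ultrafilter_def using U(1) by blast
  then show ?thesis using U(2) by blast
qed

lemma cyclic_integer_mod_group:
  assumes "n > 0"
  shows "cyclic_group (integer_mod_group n)"
\<comment> \<open>For \<open>n = 1\<close> the carrier contains only 0, not the generator 1 used
  otherwise.\<close>
proof (cases "n = 1")
  case True
  then show ?thesis using trivial_integer_mod_group trivial_imp_cyclic_group by blast
next
  case False
  have "carrier (integer_mod_group n) = range (\<lambda>i::int. 1 [^]\<^bsub>integer_mod_group n\<^esub> i)"
  proof -
    have "x \<in> range (\<lambda>x. x mod int n)" if "0 \<le> x" "x < int n" for x
      using that by (intro range_eqI[of _ _ x]) simp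
    then show ?thesis using assms by (auto simp: int_pow_integer_mod_group carrier_integer_mod_group)
  qed
  moreover have "1 \<in> carrier (integer_mod_group n)" using False by simp
  ultimately show ?thesis using group.cyclic_group[OF group_integer_mod_group] by blast
qed

text \<open>Compactness in ultraproduct form: a finite set of formulas indexes a finite cyclic group
  agreeing with \<open>A\<close> on its sentences, and for each formula the ultrafilter contains the
  family of finite sets containing it.\<close>

theorem pseudofinite_cyclic_if_cyclic_frames:
  fixes A :: "('a, 'b) monoid_scheme"
  assumes A: "comm_group A" and frames: "\<And>n. n > 0 \<Longrightarrow> \<exists>q g t. cyclic_frame A n q g t"
  shows "pseudofinite_cyclic A"
proof -
  interpret A: comm_group A by fact
  obtain F0 :: "group_formula set filter" where F: "ultrafilter F0" "F0 \<le> finite_subsets_at_top UNIV"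
    using ex_ultrafilter_le[OF finite_subsets_at_top_neq_bot] by blast
  show ?thesis
  proof (cases "finite (carrier A)")
    case True
    \<comment> \<open>At the order of \<open>A\<close> every element is torsion, so \<open>t\<close>
      generates \<open>A\<close>, and a constant ultrapower serves.\<close>
    have pos: "int (order A) > 0" using True A.order_gt_0_iff_finite by simp
    then obtain q g t where fr: "cyclic_frame A (int (order A)) q g t" using frames by blast
    have "x \<in> range (\<lambda>i::int. t [^]\<^bsub>A\<^esub> i)" if "x \<in> carrier A" for x
      using fr that A.pow_order_eq_1[OF that] unfolding cyclic_frame_def by (auto simp: int_pow_int)
    moreover have t: "t \<in> carrier A" using fr by (simp add: cyclic_frame_def)
    ultimately have "carrier A = range (\<lambda>i::int. t [^]\<^bsub>A\<^esub> i)" by auto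
    then have "cyclic_group A" using A.cyclic_group t by blast
    moreover have "F0 \<noteq> bot" using F by (simp add: ultrafilter_def)
    then have "elementarily_equivalent A (ultraproduct F0 (\<lambda>_. A))"
      using F(1) A.is_group by (simp add: elementarily_equivalent_def models_ultraproduct_iff)
    ultimately show ?thesis
      using pseudofinite_cyclicI[OF A.is_group F(1), of "\<lambda>_. A"] True A.is_group by blast
  next
    case inf: False
    have approx: "\<exists>n>0. \<forall>p\<in>S. sentence p \<longrightarrow> (models A p \<longleftrightarrow> models (integer_mod_group n) p)"
      if "finite S" for S
    proof -
      have "\<exists>K. \<forall>p\<in>S. vars_below K p"
        using that
      proof induction
        case (insert p S)
        then obtain K K' where "\<forall>p\<in>S. vars_below K p" "vars_below K' p" using ex_vars_below by blast
        then have "\<forall>q\<in>insert p S. vars_below (max K K') q"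
          using vars_below_mono by (metis insert_iff max.cobounded1 max.cobounded2)
        then show ?case by blast
      qed simp
      then obtain K where K: "\<forall>p\<in>S. vars_below K p" by blast
      have "\<exists>N L. N \<ge> 1 \<and> L \<ge> 1 \<and> (\<forall>p\<in>S. \<forall>\<Lambda> (H :: int monoid) e f.
        L dvd \<Lambda> \<longrightarrow> framed K \<Lambda> A e \<longrightarrow> framed K \<Lambda> H f \<longrightarrow> large K N \<Lambda> A \<longrightarrow> large K N \<Lambda> H \<longrightarrow>
        similar K N L A e H f \<longrightarrow> (sat A e p \<longleftrightarrow> sat H f p))"
        using that K
      proof induction
        case empty
        show ?case by (rule exI[of _ 1], rule exI[of _ 1]) simp
      next
        case (insert p S)
        obtain N1 L1 where 1: "N1 \<ge> 1" "L1 \<ge> 1" "\<And>p \<Lambda> (H :: int monoid) e f. p \<in> S \<Longrightarrow>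
          L1 dvd \<Lambda> \<Longrightarrow> framed K \<Lambda> A e \<Longrightarrow> framed K \<Lambda> H f \<Longrightarrow> large K N1 \<Lambda> A \<Longrightarrow> large K N1 \<Lambda> H \<Longrightarrow>
          similar K N1 L1 A e H f \<Longrightarrow> (sat A e p \<longleftrightarrow> sat H f p)"
          using insert.IH insert.prems by (smt (verit) insert_iff)
        obtain N2 L2 where 2: "N2 \<ge> 1" "L2 \<ge> 1" "\<And>\<Lambda> (H :: int monoid) e f.
          L2 dvd \<Lambda> \<Longrightarrow> framed K \<Lambda> A e \<Longrightarrow> framed K \<Lambda> H f \<Longrightarrow> large K N2 \<Lambda> A \<Longrightarrow> large K N2 \<Lambda> H \<Longrightarrow>
          similar K N2 L2 A e H f \<Longrightarrow> (sat A e p \<longleftrightarrow> sat H f p)"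
          using sat_transfer[of K p] insert.prems by (metis insertI1)
        show ?case
        proof (rule exI[of _ "max N1 N2"], rule exI[of _ "L1 * L2"], intro conjI allI impI ballI)
          fix r \<Lambda> e f and H :: "int monoid"
          assume r: "r \<in> insert p S" and "L1 * L2 dvd \<Lambda>" and fr: "framed K \<Lambda> A e" "framed K \<Lambda> H f"
            and large: "large K (max N1 N2) \<Lambda> A" "large K (max N1 N2) \<Lambda> H"
            and sim: "similar K (max N1 N2) (L1 * L2) A e H f"
          then have dvd: "L1 dvd \<Lambda>" "L2 dvd \<Lambda>" by (auto dest: dvd_mult_left dvd_mult_right)
          have N: "0 \<le> N1" "N1 \<le> max N1 N2" "0 \<le> N2" "N2 \<le> max N1 N2" using 1(1) 2(1) by auto
          show "sat A e r \<longleftrightarrow> sat H f r"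
            using r 1(3)[OF _ dvd(1) fr large_mono[OF large(1) N(1,2)] large_mono[OF large(2) N(1,2)] similar_mono[OF sim N(2)]]
              2(3)[OF dvd(2) fr large_mono[OF large(1) N(3,4)] large_mono[OF large(2) N(3,4)] similar_mono[OF sim N(4)]]
            by auto
        qed (use 1(1,2) 2(1,2) mult_mono[of 1 L1 1 L2] in auto)
      qed
      \<comment> \<open>From here on the modulus of the frames is \<open>L\<close> itself.\<close>
      then obtain N L where N: "N \<ge> 1" and L: "L \<ge> 1" and transfer: "\<And>p (H :: int monoid) e f. p \<in> S \<Longrightarrow>
        framed K L A e \<Longrightarrow> framed K L H f \<Longrightarrow> large K N L A \<Longrightarrow> large K N L H \<Longrightarrow>
        similar K N L A e H f \<Longrightarrow> (sat A e p \<longleftrightarrow> sat H f p)" by (metis dvd_refl)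
      have "L > 0" using L by simp
      then obtain q g0 t where "cyclic_frame A L q g0 t" using frames by blast
      then obtain g where fr: "cyclic_frame A L q g t" and ind: "independent_frame A N g t"
        using independent_generator[OF frames inf] by blast
      have gt: "g \<in> carrier A" "t \<in> carrier A" using fr by (auto simp: cyclic_frame_def)
      obtain c :: int and y where y: "y \<in> carrier A" "t = g [^]\<^bsub>A\<^esub> c \<otimes>\<^bsub>A\<^esub> y [^]\<^bsub>A\<^esub> L"
        using fr gt unfolding cyclic_frame_def by blast
      obtain n g' t' y' where n: "n > 0" "(2 * N + 1) ^ (K + 2) * L\<^sup>2 < int n"
        and frZ: "cyclic_frame (integer_mod_group n) L q g' t'" and indZ: "independent_frame (integer_mod_group n) N g' t'"
        and y': "y' \<in> carrier (integer_mod_group n)"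
          "t' = g' [^]\<^bsub>integer_mod_group n\<^esub> c \<otimes>\<^bsub>integer_mod_group n\<^esub> y' [^]\<^bsub>integer_mod_group n\<^esub> L"
        using cyclic_companion[OF fr y, of "(2 * N + 1) ^ (K + 2) * L\<^sup>2" N] by blast
      let ?Z = "integer_mod_group n" and ?e = "frame_env A K g t" and ?f = "frame_env (integer_mod_group n) K g' t'"
      have gt': "g' \<in> carrier ?Z" "t' \<in> carrier ?Z" using frZ by (auto simp only: cyclic_frame_def)
      have "large K N L A" using inf by (simp add: large_def)
      moreover have "large K N L ?Z" using n by (simp add: large_def carrier_integer_mod_group)
      moreover have "similar K N L A ?e ?Z ?f" by (rule similar_frame_env[OF fr ind y frZ indZ y'])
      ultimately have "sat A ?e p \<longleftrightarrow> sat ?Z ?f p" if "p \<in> S" for p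
        using transfer[OF that framed_frame_env[OF fr] framed_frame_env[OF frZ]] by blast
      moreover have "models A p \<longleftrightarrow> sat A ?e p" "models ?Z p \<longleftrightarrow> sat ?Z ?f p" if "sentence p" for p
        using models_sentence[OF that] range_frame_env gt gt' A.is_monoid group.is_monoid[OF group_integer_mod_group]
        by metis+
      ultimately show ?thesis using n(1) by blast
    qed
    define \<nu> where "\<nu> S = (SOME n. n > 0 \<and> (\<forall>p\<in>S. sentence p \<longrightarrow> (models A p \<longleftrightarrow> models (integer_mod_group n) p)))" for S
    have \<nu>: "\<nu> S > 0" "\<And>p. p \<in> S \<Longrightarrow> sentence p \<Longrightarrow> models A p \<longleftrightarrow> models (integer_mod_group (\<nu> S)) p" if "finite S" for S
      using someI_ex[OF approx[OF that]] unfolding \<nu>_def by blast+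
    \<comment> \<open>Infinite index sets get the trivial group; the ultrafilter ignores them, as it
      refines \<open>finite_subsets_at_top\<close>.\<close>
    define C where "C S = integer_mod_group (if finite S then \<nu> S else 1)" for S
    have C: "group (C S) \<and> cyclic_group (C S) \<and> finite (carrier (C S))" for S
      using \<nu>(1)[of S] cyclic_integer_mod_group by (auto simp: C_def carrier_integer_mod_group)
    have "models A p \<longleftrightarrow> models (ultraproduct F0 C) p" if p: "sentence p" for p
    proof -
      have "\<forall>\<^sub>F S in finite_subsets_at_top UNIV. models (C S) p \<longleftrightarrow> models A p"
        unfolding eventually_finite_subsets_at_top
        by (intro exI[of _ "{p}"]) (use \<nu>(2) p in \<open>auto simp: C_def\<close>)
      then have ev: "\<forall>\<^sub>F S in F0. models (C S) p \<longleftrightarrow> models A p" using F(2) by (rule filter_leD[rotated])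
      then have "(\<forall>\<^sub>F S in F0. models (C S) p) \<longleftrightarrow> (\<forall>\<^sub>F S in F0. models A p)" by (rule eventually_cong) auto
      moreover have "F0 \<noteq> bot" using F by (simp add: ultrafilter_def)
      ultimately show ?thesis using models_ultraproduct_iff[of C F0 p] C F(1) p by simp
    qed
    then have "elementarily_equivalent A (ultraproduct F0 C)" by (simp add: elementarily_equivalent_def)
    then show ?thesis by (rule pseudofinite_cyclicI[OF A.is_group F(1) C])
  qed
qed

text \<open>Beyond commutativity, the field enters through the bound on roots of unity; divisibility
  and surjectivity enter through the frames of the kernel.\<close>

theorem theorem5p24:
  fixes K :: "('a, 'b) ring_scheme" and \<phi> :: "'a \<Rightarrow> 'a"
  assumes "field K"
    and "divisible_group (mult_of K)"
    and "\<phi> \<in> epi (mult_of K) (mult_of K)"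
  shows "pseudofinite_cyclic ((mult_of K)\<lparr>carrier := kernel (mult_of K) (mult_of K) \<phi>\<rparr>)"
proof -
  interpret field K by fact
  let ?G = "mult_of K"
  have G: "comm_group ?G"
    using field_mult_group by (intro group.group_comm_groupI) (auto simp: m_comm)
  interpret G: comm_group ?G by (rule G)
  interpret \<phi>: group_hom ?G ?G \<phi> using assms(3) by unfold_locales (simp add: epi_def)
  have bound: "finite {x \<in> carrier ?G. x [^]\<^bsub>?G\<^esub> d = \<one>\<^bsub>?G\<^esub>} \<and> card {x \<in> carrier ?G. x [^]\<^bsub>?G\<^esub> d = \<one>\<^bsub>?G\<^esub>} \<le> d"
    if "d > 0" for d :: nat
  proof -
    have sub: "{x \<in> carrier ?G. x [^]\<^bsub>?G\<^esub> d = \<one>\<^bsub>?G\<^esub>} \<subseteq> {x \<in> carrier K. x [^]\<^bsub>K\<^esub> d = \<one>\<^bsub>K\<^esub>}"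
      by (auto simp: Multiplicative_Group.nat_pow_mult_of)
    show ?thesis
      using finite_subset[OF sub roots_of_unity(1)[OF that]]
        card_mono[OF roots_of_unity(1)[OF that] sub] roots_of_unity(2)[OF that] by auto
  qed
  have sub: "subgroup (kernel ?G ?G \<phi>) ?G" by (rule \<phi>.subgroup_kernel)
  show ?thesis
  proof (rule pseudofinite_cyclic_if_cyclic_frames)
    show "comm_group (?G\<lparr>carrier := kernel ?G ?G \<phi>\<rparr>)"
      using subgroup.subgroup_is_group[OF sub G.is_group] G.m_comm
      by (intro group.group_comm_groupI) (auto simp: kernel_def)
    fix n :: int assume n: "n > 0"
    then have "nat n > 0" by simp
    from G.torsion_cyclic[OF bound this]
    obtain z where z: "z \<in> carrier ?G" "z [^]\<^bsub>?G\<^esub> nat n = \<one>\<^bsub>?G\<^esub>"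
      "\<And>x. x \<in> carrier ?G \<Longrightarrow> x [^]\<^bsub>?G\<^esub> nat n = \<one>\<^bsub>?G\<^esub> \<Longrightarrow> \<exists>i::int. x = z [^]\<^bsub>?G\<^esub> i" by blast
    have "x [^]\<^bsub>?G\<^esub> nat n = x [^]\<^bsub>?G\<^esub> n" for x using n int_pow_int[of ?G x "nat n"] by simp
    with z show "\<exists>q g t. cyclic_frame (?G\<lparr>carrier := kernel ?G ?G \<phi>\<rparr>) n q g t"
      by (intro kernel_cyclic_frame[OF G assms(2,3) n]) auto
  qed
qed

end
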